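(* Let $\varphi$ be an admissible order function and $a_0:\mathbb{R}^d\setminus\{0\}\to[\Lambda_1,\Lambda_2]$ measurable ($0<\Lambda_1\le\Lambda_2$), and let $(P_t)_{t\ge0}$ be the semigroup associated with the Lévy measure $\nu(dh)=\frac{a_0(h)}{|h|^d\varphi(|h|)}dh$ (see context). If $f\in C^0(\mathbb{R}^d)$, then $P_tf\in C^\infty(\mathbb{R}^d)$ for every $t>0$, and for each multi-index $\gamma$ with $|\gamma|=k$ there exists $C>0$ (depending on $k$) such that $$|D^\gamma P_tf(x)|\le C\,\varphi^{-1}(t)^{-k}\|f\|_{C^0}\qquad(t>0,\ x\in\mathbb{R}^d).$$
   Context: An admissible order function is a smooth $\varphi:(0,\infty)\to(0,\infty)$ with $\varphi(1)=1$ such that $\phi(r):=\varphi(r^{-1/2})^{-1}$ is a Bernstein function (i.e. $\phi\ge0$ is $C^\infty$ on $(0,\infty)$ with $(-1)^n\phi^{(n)}\le0$ for all $n\in\mathbb{N}$) and there are constants $0<\delta_1\le\delta_2<1$, $a_1\in(0,1]$, $a_2\in[1,\infty)$ with $a_1\lambda^{2\delta_1}\varphi(r)\le\varphi(\lambda r)\le a_2\lambda^{2\delta_2}\varphi(r)$ for all $\lambda\ge1$, $r>0$. In particular $\varphi$ is increasing and $\varphi^{-1}$ denotes its inverse function. $C^0(\mathbb{R}^d)$ is the space of bounded continuous functions with the sup norm $\|\cdot\|_{C^0}$. $(P_t)$ is the semigroup $P_tf(x)=\mathbb{E}[f(x+Y_t)]$, where $Y$ is the Lévy process on $\mathbb{R}^d$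 with $\mathbb{E}[e^{i\xi\cdot Y_t}]=\exp\big(-t\int_{\mathbb{R}^d}(1-e^{i\xi\cdot h}+i\xi\cdot h\,\mathbb{1}_{\{|h|\le1\}})\,\nu(dh)\big)$; equivalently, $(P_t)$ is the strongly continuous contraction semigroup on $C_\infty(\mathbb{R}^d)$ whose generator coincides on $C^2_\infty(\mathbb{R}^d)$ with $\mathcal{L}_0u(x)=\int_{\mathbb{R}^d}(u(x+h)-u(x)-\nabla u(x)\cdot h\mathbb{1}_{\{|h|\le1\}})\frac{a_0(h)}{|h|^d\varphi(|h|)}dh$. *)

theory Defs
  imports "HOL-Probability.Probability"
begin

definition smooth_pos :: "(real \<Rightarrow> real) \<Rightarrow> bool" where
  "smooth_pos g \<longleftrightarrow> (\<forall>n r. r > 0 \<longrightarrow> ((deriv ^^ n) g) differentiable (at r))"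

definition bernstein :: "(real \<Rightarrow> real) \<Rightarrow> bool" where
  "bernstein g \<longleftrightarrow> (\<forall>r>0. g r \<ge> 0) \<and> smooth_pos g \<and>
     (\<forall>n\<ge>1. \<forall>r>0. (-1) ^ n * (deriv ^^ n) g r \<le> 0)"

definition admissible_order :: "(real \<Rightarrow> real) \<Rightarrow> bool" where
  "admissible_order \<phi> \<longleftrightarrow>
     (\<forall>r>0. \<phi> r > 0) \<and> \<phi> 1 = 1 \<and> smooth_pos \<phi> \<and>
     bernstein (\<lambda>r. inverse (\<phi> (r powr (-1/2)))) \<and>
     (\<exists>\<delta>1 \<delta>2 a1 a2. 0 < \<delta>1 \<and> \<delta>1 \<le> \<delta>2 \<and> \<delta>2 < 1 \<and> 0 < a1 \<and> a1 \<le> 1 \<and> 1 \<le> a2 \<and>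
        (\<forall>l r. l \<ge> 1 \<longrightarrow> r > 0 \<longrightarrow>
           a1 * l powr (2*\<delta>1) * \<phi> r \<le> \<phi> (l * r) \<and>
           \<phi> (l * r) \<le> a2 * l powr (2*\<delta>2) * \<phi> r))"

definition order_inv :: "(real \<Rightarrow> real) \<Rightarrow> real \<Rightarrow> real" where
  "order_inv \<phi> t = inv_into {0<..} \<phi> t"

definition levy_measure :: "('a::euclidean_space \<Rightarrow> real) \<Rightarrow> (real \<Rightarrow> real) \<Rightarrow> 'a measure" where
  "levy_measure a0 \<phi> = density lborel
     (\<lambda>h. ennreal (a0 h / (norm h ^ DIM('a) * \<phi> (norm h))))"

definition levy_exponent :: "'a::euclidean_space measure \<Rightarrow> 'a \<Rightarrow> complex" where
  "levy_exponent \<nu> \<xi> = (LINT h|\<nu>. 1 - cis (\<xi> \<bullet> h)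
        + \<i> * complex_of_real (\<xi> \<bullet> h) * complex_of_real (indicator (cball 0 1) h))"

definition is_levy_law :: "'a::euclidean_space measure \<Rightarrow> real \<Rightarrow> 'a measure \<Rightarrow> bool" where
  "is_levy_law \<nu> t \<mu> \<longleftrightarrow> prob_space \<mu> \<and> sets \<mu> = sets borel \<and>
     (\<forall>\<xi>. (LINT y|\<mu>. cis (\<xi> \<bullet> y)) = exp (- complex_of_real t * levy_exponent \<nu> \<xi>))"

definition semigroup :: "(real \<Rightarrow> 'a::euclidean_space measure) \<Rightarrow> real \<Rightarrow> ('a \<Rightarrow> real) \<Rightarrow> 'a \<Rightarrow> real" where
  "semigroup \<mu> t f x = (LINT y|\<mu> t. f (x + y))"

text \<open>Iterated partial derivatives D^gamma, the multi-index gamma given as a list of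
  basis directions (|gamma| = length).\<close>
fun pderivs :: "'a::euclidean_space list \<Rightarrow> ('a \<Rightarrow> real) \<Rightarrow> 'a \<Rightarrow> real" where
  "pderivs [] g = g"
| "pderivs (i # is) g = (\<lambda>x. frechet_derivative (pderivs is g) (at x) i)"

definition smooth_Rd :: "('a::euclidean_space \<Rightarrow> real) \<Rightarrow> bool" where
  "smooth_Rd g \<longleftrightarrow> (\<forall>is. set is \<subseteq> Basis \<longrightarrow> (\<forall>x. pderivs is g differentiable (at x)))"

definition sup_norm :: "('a \<Rightarrow> real) \<Rightarrow> real" where
  "sup_norm f = (SUP x. \<bar>f x\<bar>)"

end

theory Submission
  imports Defs
begin

text \<open>Write \<open>exp (- t \<psi>)\<close> for the characteristic function of \<open>\<mu> t\<close>. On a trigonometric polynomial the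
  operator \<open>D\<^sup>\<gamma> P\<^sub>t\<close> multiplies the coefficient of frequency \<open>\<xi>\<close> by \<open>(i \<xi>)\<^sup>\<gamma> exp (- t \<psi> \<xi>)\<close>, so it suffices to
  bound this multiplier in the sup-norm operator norm; continuous bounded functions are then reached by
  approximation. Splitting the exponential into \<open>k + 1\<close> equal factors reduces to a single derivative. Put \<open>r = \<phi>\<^sup>-\<^sup>1 t\<close>.
  On a dyadic cube of side about \<open>2\<^sup>-\<^sup>n r\<close> the Levy measure dominates a multiple \<open>w\<^sub>n / t\<close> of the uniform
  law with \<open>w\<^sub>n\<close> growing geometrically. Given that a jump occurs in the \<open>n\<close>-th cube, one derivative costs \<open>2\<^sup>n / r\<close>,
  by the smoothing of the uniform law, and the probability that no jump occurs in the earlier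
  cubes is \<open>exp (- w\<^sub>0 - \<dots> - w\<^bsub>n-1\<^esub>)\<close>, which makes the sum over \<open>n\<close> converge to a multiple of \<open>1 / r\<close>. All
  remaining jumps contribute a contraction.\<close>

section \<open>Multipliers on trigonometric polynomials\<close>

text \<open>Only the characteristic functions of the laws \<open>\<mu> t\<close> are given: no
  process, no jumps and no transition density are at hand. Probabilistic statements are therefore
  read as norms of multipliers: a product stands for an independent sum,
  \<open>cis (\<xi> \<bullet> a)\<close> for a shift, and limits are pointwise limits of
  multipliers. Since \<open>a0\<close> has no regularity, the jump law as a whole cannot be
  differentiated; only its lower bound serves for smoothing: multiples of uniform laws are
  subtracted, and the nonnegative rest is again a Levy density. Compensation in the unit ball leaves
  a drift, which is a translation and hence free at every scale. A single cube would not do: the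
  event of no jump in it has positive probability and leaves a remainder on which no derivative is
  controlled. Cubes shrinking to the origin remove it, and the lower scaling exponent \<delta>1 > 0
  makes their weights grow like \<open>2 powr (2 * \<delta>1 * n)\<close>, so that the no-jump
  probability beats the cost 2^n.\<close>

definition trig :: "'a::euclidean_space set \<Rightarrow> ('a \<Rightarrow> complex) \<Rightarrow> 'a \<Rightarrow> complex" where
  "trig A c x = (\<Sum>\<xi>\<in>A. c \<xi> * cis (\<xi> \<bullet> x))"

text \<open>The Fourier multiplier \<open>m\<close> has norm at most \<open>K\<close> on the almost periodic functions. Stating this on the
  coefficients avoids the uniqueness of Fourier coefficients.\<close>

definition mult_bound :: "('a::euclidean_space \<Rightarrow> complex) \<Rightarrow> real \<Rightarrow> bool" where
  "mult_bound m K \<longleftrightarrow> 0 \<le> K \<and> (\<forall>A c B. finite A \<longrightarrow> (\<forall>x. cmod (trig A c x) \<le> B) \<longrightarrow>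
     (\<forall>x. cmod (trig A (\<lambda>\<xi>. m \<xi> * c \<xi>) x) \<le> K * B))"

text \<open>The premise \<open>0 \<le> B\<close> is free, because \<open>B\<close> dominates a
  modulus; enlarging the constant in \<open>mult_bound_mono\<close> relies on it.\<close>

lemma mult_boundI:
  assumes "0 \<le> K"
    and "\<And>A c B x. finite A \<Longrightarrow> (\<And>x. cmod (trig A c x) \<le> B) \<Longrightarrow> 0 \<le> B \<Longrightarrow>
      cmod (trig A (\<lambda>\<xi>. m \<xi> * c \<xi>) x) \<le> K * B"
  shows "mult_bound m K"
  unfolding mult_bound_def using assms norm_ge_zero order_trans by blast

lemma mult_boundD:
  "mult_bound m K \<Longrightarrow> finite A \<Longrightarrow> (\<And>x. cmod (trig A c x) \<le> B) \<Longrightarrow>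
    cmod (trig A (\<lambda>\<xi>. m \<xi> * c \<xi>) x) \<le> K * B"
  unfolding mult_bound_def by blast

lemma mult_bound_nonneg: "mult_bound m K \<Longrightarrow> 0 \<le> K"
  unfolding mult_bound_def by blast

lemma mult_bound_mono:
  assumes m: "mult_bound m K" and "K \<le> L"
  shows "mult_bound m L"
proof (rule mult_boundI)
  show "0 \<le> L" using mult_bound_nonneg[OF m] assms(2) by simp
next
  fix A :: "'a set" and c B x
  assume *: "finite A" "\<And>x. cmod (trig A c x) \<le> B" and B: "0 \<le> B"
  show "cmod (trig A (\<lambda>\<xi>. m \<xi> * c \<xi>) x) \<le> L * B"
    using mult_boundD[OF m *] mult_right_mono[OF assms(2) B] by (meson order_trans)
qed

lemma mult_bound_const: "mult_bound (\<lambda>_. z) (cmod z)"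
proof (rule mult_boundI)
  fix A :: "'a set" and c B x
  assume *: "finite A" "\<And>x. cmod (trig A c x) \<le> B"
  have "trig A (\<lambda>\<xi>. z * c \<xi>) x = z * trig A c x"
    by (simp add: trig_def sum_distrib_left mult.assoc)
  then show "cmod (trig A (\<lambda>\<xi>. z * c \<xi>) x) \<le> cmod z * B"
    by (simp add: norm_mult mult_left_mono *)
qed simp

text \<open>The operator is the shift by \<open>a\<close>. This disposes of every drift term that
  compensation produces.\<close>

lemma mult_bound_cis: "mult_bound (\<lambda>\<xi>. cis (\<xi> \<bullet> a)) 1"
proof (rule mult_boundI)
  fix A :: "'a set" and c B x
  assume *: "finite A" "\<And>x. cmod (trig A c x) \<le> B"
  have "trig A (\<lambda>\<xi>. cis (\<xi> \<bullet> a) * c \<xi>) x = trig A c (x + a)"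
    by (simp add: trig_def inner_add_right cis_mult[symmetric] mult_ac)
  then show "cmod (trig A (\<lambda>\<xi>. cis (\<xi> \<bullet> a) * c \<xi>) x) \<le> 1 * B"
    by (simp add: *)
qed simp

text \<open>Multiplying multipliers composes the operators, so the constants behave like a
  submultiplicative norm.\<close>

lemma mult_bound_mult:
  assumes m: "mult_bound m K" and m': "mult_bound m' K'"
  shows "mult_bound (\<lambda>\<xi>. m \<xi> * m' \<xi>) (K * K')"
proof (rule mult_boundI)
  show "0 \<le> K * K'" using mult_bound_nonneg[OF m] mult_bound_nonneg[OF m'] by simp
next
  fix A :: "'a set" and c B x
  assume *: "finite A" "\<And>x. cmod (trig A c x) \<le> B"
  show "cmod (trig A (\<lambda>\<xi>. m \<xi> * m' \<xi> * c \<xi>) x) \<le> K * K' * B"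
    using mult_boundD[OF m *(1) mult_boundD[OF m' *]] by (simp add: mult.assoc)
qed

lemma mult_bound_cmult:
  "mult_bound m K \<Longrightarrow> mult_bound (\<lambda>\<xi>. z * m \<xi>) (cmod z * K)"
  by (rule mult_bound_mult[OF mult_bound_const])

lemma mult_bound_add:
  assumes m: "mult_bound m K" and m': "mult_bound m' K'"
  shows "mult_bound (\<lambda>\<xi>. m \<xi> + m' \<xi>) (K + K')"
proof (rule mult_boundI)
  show "0 \<le> K + K'" using mult_bound_nonneg[OF m] mult_bound_nonneg[OF m'] by simp
next
  fix A :: "'a set" and c B x
  assume *: "finite A" "\<And>x. cmod (trig A c x) \<le> B"
  have "trig A (\<lambda>\<xi>. (m \<xi> + m' \<xi>) * c \<xi>) x = trig A (\<lambda>\<xi>. m \<xi> * c \<xi>) x + trig A (\<lambda>\<xi>. m' \<xi> * c \<xi>) x"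
    by (simp add: trig_def sum.distrib[symmetric] algebra_simps)
  then show "cmod (trig A (\<lambda>\<xi>. (m \<xi> + m' \<xi>) * c \<xi>) x) \<le> (K + K') * B"
    using mult_boundD[OF m *, of x] mult_boundD[OF m' *, of x]
    by (metis (no_types, lifting) add_mono distrib_right norm_triangle_le)
qed

lemma mult_bound_sum:
  assumes "\<And>n. n < (N::nat) \<Longrightarrow> mult_bound (m n) (K n)"
  shows "mult_bound (\<lambda>\<xi>. \<Sum>n<N. m n \<xi>) (\<Sum>n<N. K n)"
  using assms
proof (induction N)
  case 0
  then show ?case using mult_bound_const[of 0] by simp
next
  case (Suc N)
  then show ?case by (simp add: mult_bound_add)
qed

lemma mult_bound_power:
  "mult_bound m K \<Longrightarrow> mult_bound (\<lambda>\<xi>. m \<xi> ^ n) (K ^ n)"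
proof (induction n)
  case 0
  then show ?case using mult_bound_const[of 1] by simp
next
  case (Suc n)
  then show ?case by (simp add: mult_bound_mult)
qed

text \<open>Finitely many frequencies occur in each trigonometric polynomial, so no uniformity in
  \<xi> is needed. This passes from truncated to full jump measures, from difference quotients to
  derivatives, and from finitely many cubes to all of them.\<close>

lemma mult_bound_limit:
  assumes lim: "\<And>\<xi>. (\<lambda>n. m n \<xi>) \<longlonglongrightarrow> m' \<xi>" and m: "\<And>n. mult_bound (m n) K"
  shows "mult_bound m' K"
proof (rule mult_boundI)
  show "0 \<le> K" using m mult_bound_nonneg by blast
next
  fix A :: "'a set" and c B x
  assume *: "finite A" "\<And>x. cmod (trig A c x) \<le> B"
  have "(\<lambda>n. trig A (\<lambda>\<xi>. m n \<xi> * c \<xi>) x) \<longlonglongrightarrow> trig A (\<lambda>\<xi>. m' \<xi> * c \<xi>) x"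
    unfolding trig_def by (intro tendsto_intros lim)
  then show "cmod (trig A (\<lambda>\<xi>. m' \<xi> * c \<xi>) x) \<le> K * B"
    by (rule tendsto_norm[THEN LIMSEQ_le_const2]) (use mult_boundD[OF m *] in auto)
qed

lemma mult_bound_series:
  assumes m: "\<And>n. mult_bound (m n) (K n)" and "summable K"
    and lim: "\<And>\<xi>. (\<lambda>n. m n \<xi>) sums m' \<xi>"
  shows "mult_bound m' (suminf K)"
proof (rule mult_bound_limit)
  show "mult_bound (\<lambda>\<xi>. \<Sum>n<N. m n \<xi>) (suminf K)" for N
    by (rule mult_bound_mono[OF mult_bound_sum[OF m]])
      (use assms mult_bound_nonneg in \<open>auto intro!: sum_le_suminf\<close>)
qed (use lim in \<open>auto simp: sums_def\<close>)

section \<open>Exponentials of multipliers and compound Poisson factors\<close>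

lemma mult_bound_exp:
  assumes "mult_bound m K"
  shows "mult_bound (\<lambda>\<xi>. exp (m \<xi>)) (exp K)"
proof -
  have "mult_bound (\<lambda>\<xi>. exp (m \<xi>)) (\<Sum>n. inverse (fact n) * K ^ n)"
  proof (rule mult_bound_series)
    show "mult_bound (\<lambda>\<xi>. inverse (fact n) * m \<xi> ^ n) (inverse (fact n) * K ^ n)" for n
      using mult_bound_cmult[OF mult_bound_power[OF assms], of "inverse (fact n)" n]
      by (simp add: norm_inverse)
    show "summable (\<lambda>n. inverse (fact n) * K ^ n)" by (rule summable_exp)
    show "(\<lambda>n. inverse (fact n) * m \<xi> ^ n) sums exp (m \<xi>)" for \<xi>
      using exp_converges[of "m \<xi>"] by (simp add: scaleR_conv_of_real)
  qed
  then show ?thesis by (simp add: exp_def)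
qed

text \<open>Subtracting 1 removes the constant term of the series, on which \<open>D\<close> would
  stand alone and unbounded. Every other term contains a factor \<open>m\<close> to which
  \<open>D\<close> can be attached, at cost \<open>L\<close>.\<close>

lemma mult_bound_exp_minus_1:
  assumes m: "mult_bound m 1" and D: "mult_bound (\<lambda>\<xi>. D \<xi> * m \<xi>) L" and w: "0 \<le> w"
  shows "mult_bound (\<lambda>\<xi>. D \<xi> * (exp (of_real w * m \<xi>) - 1)) ((exp w - 1) * L)"
proof -
  have s: "(\<lambda>n. w ^ Suc n / fact (Suc n)) sums (exp w - 1)"
    using exp_converges[of w] sums_Suc_iff[of "\<lambda>n. w ^ n / fact n" "exp w - 1"]
    by (simp add: field_simps)
  have "mult_bound (\<lambda>\<xi>. D \<xi> * (exp (of_real w * m \<xi>) - 1)) (\<Sum>n. w ^ Suc n / fact (Suc n) * L)"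
  proof (rule mult_bound_series)
    show "summable (\<lambda>n. w ^ Suc n / fact (Suc n) * L)"
      using s summable_mult2 sums_iff by blast
    fix n
    let ?a = "complex_of_real (w ^ Suc n / fact (Suc n))"
    have "mult_bound (\<lambda>\<xi>. ?a * (D \<xi> * m \<xi> * m \<xi> ^ n)) (cmod ?a * (L * 1 ^ n))"
      by (intro mult_bound_cmult mult_bound_mult D mult_bound_power m)
    also have "cmod ?a = w ^ Suc n / fact (Suc n)" unfolding norm_of_real using w by simp
    also have "(\<lambda>\<xi>. ?a * (D \<xi> * m \<xi> * m \<xi> ^ n)) = (\<lambda>\<xi>. D \<xi> * ((of_real w * m \<xi>) ^ Suc n / fact (Suc n)))"
      by (simp add: power_mult_distrib mult_ac del: fact_Suc)
    finally show "mult_bound (\<lambda>\<xi>. D \<xi> * ((of_real w * m \<xi>) ^ Suc n / fact (Suc n))) (w ^ Suc n / fact (Suc n) * L)"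
      by simp
  next
    fix \<xi>
    have "(\<lambda>n. (of_real w * m \<xi>) ^ Suc n / fact (Suc n)) sums (exp (of_real w * m \<xi>) - 1)"
      using exp_converges[of "of_real w * m \<xi>"] sums_Suc_iff[of "\<lambda>n. (of_real w * m \<xi>) ^ n / fact n" "exp (of_real w * m \<xi>) - 1"]
      by (simp add: scaleR_conv_of_real field_simps)
    then show "(\<lambda>n. D \<xi> * ((of_real w * m \<xi>) ^ Suc n / fact (Suc n))) sums (D \<xi> * (exp (of_real w * m \<xi>) - 1))"
      by (rule sums_mult)
  qed
  moreover have "(\<Sum>n. w ^ Suc n / fact (Suc n) * L) = (exp w - 1) * L"
    using sums_mult2[OF s, of L] sums_unique by metis
  ultimately show ?thesis by metis
qed

text \<open>The operator averages the translates of the polynomial against \<open>g\<close>, so its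
  norm is at most the L1 norm of \<open>g\<close>.\<close>

lemma mult_bound_fourier:
  assumes g: "integrable lborel g"
  shows "mult_bound (\<lambda>\<xi>::'a::euclidean_space. LINT h|lborel. g h *\<^sub>R cis (\<xi> \<bullet> h)) (LINT h|lborel. \<bar>g h\<bar>)"
proof (rule mult_boundI)
  fix A :: "'a set" and c B x
  assume *: "finite A" "\<And>x. cmod (trig A c x) \<le> B"
  have i: "integrable lborel (\<lambda>h. g h *\<^sub>R cis (\<xi> \<bullet> h))" for \<xi> :: 'a
    by (rule Bochner_Integration.integrable_bound[OF g]) (use g in \<open>auto simp: cis_conv_exp\<close>)
  have i2: "integrable lborel (\<lambda>h. g h *\<^sub>R cis (\<xi> \<bullet> h) * c \<xi> * cis (\<xi> \<bullet> x))" for \<xi> :: 'a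
    using i by (intro integrable_mult_left)
  have "trig A (\<lambda>\<xi>. (LINT h|lborel. g h *\<^sub>R cis (\<xi> \<bullet> h)) * c \<xi>) x
     = (\<Sum>\<xi>\<in>A. LINT h|lborel. g h *\<^sub>R cis (\<xi> \<bullet> h) * c \<xi> * cis (\<xi> \<bullet> x))"
    unfolding trig_def using i by (simp only: integral_mult_left_zero)
  also have "\<dots> = (LINT h|lborel. (\<Sum>\<xi>\<in>A. g h *\<^sub>R cis (\<xi> \<bullet> h) * c \<xi> * cis (\<xi> \<bullet> x)))"
    by (rule Bochner_Integration.integral_sum[symmetric]) (rule i2)
  also have "\<dots> = (LINT h|lborel. g h *\<^sub>R trig A c (x + h))"
    by (intro Bochner_Integration.integral_cong)
      (auto simp: trig_def scaleR_sum_right inner_add_right cis_mult[symmetric] mult_ac intro!: sum.cong)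
  also have "cmod \<dots> \<le> (LINT h|lborel. \<bar>g h\<bar> * B)"
  proof (rule Bochner_Integration.integral_norm_bound_integral)
    show "integrable lborel (\<lambda>h. g h *\<^sub>R trig A c (x + h))"
      using i2 by (auto simp: trig_def scaleR_sum_right inner_add_right cis_mult[symmetric] mult_ac)
  qed (use g * in \<open>auto intro!: mult_left_mono\<close>)
  finally show "cmod (trig A (\<lambda>\<xi>. (LINT h|lborel. g h *\<^sub>R cis (\<xi> \<bullet> h)) * c \<xi>) x) \<le> (LINT h|lborel. \<bar>g h\<bar>) * B"
    by simp
qed simp

text \<open>Each exponential is a compound Poisson law with rate \<open>w n\<close> and jump law
  \<open>U n\<close>; the subtracted constant is the event of no jump at all. The n-th summand of
  the bound belongs to the event that the first jump source to act is the n-th: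
  \<open>exp (- (\<Sum>m<n. w m))\<close> for the silence of the earlier ones, and
  \<open>L n\<close> for putting \<open>D\<close> on a jump of source n.\<close>

lemma mult_bound_compound:
  assumes U: "\<And>n. mult_bound (U n) 1" and D: "\<And>n. mult_bound (\<lambda>\<xi>. D \<xi> * U n \<xi>) (L n)"
    and w: "\<And>n. 0 \<le> w n"
  shows "mult_bound (\<lambda>\<xi>. D \<xi> * ((\<Prod>n<N. exp (of_real (w n) * (U n \<xi> - 1))) - of_real (exp (- (\<Sum>n<N. w n)))))
    (\<Sum>n<(N::nat). exp (- (\<Sum>m<n. w m)) * L n)"
proof (induction N)
  case 0
  then show ?case using mult_bound_const[of 0] by simp
next
  case (Suc N)
  let ?E = "\<lambda>n \<xi>. exp (of_real (w n) * (U n \<xi> - 1))"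
  let ?S = "\<lambda>N. exp (- (\<Sum>n<N. w n))"
  have e: "?E n \<xi> = of_real (exp (- w n)) * exp (of_real (w n) * U n \<xi>)" for n \<xi>
    by (simp add: exp_of_real[symmetric] exp_add[symmetric] algebra_simps del: exp_of_real)
  have E: "mult_bound (?E N) 1"
  proof -
    have "mult_bound (\<lambda>\<xi>. of_real (exp (- w N)) * exp (of_real (w N) * U N \<xi>))
        (cmod (of_real (exp (- w N))) * exp (cmod (of_real (w N)) * 1))"
      by (intro mult_bound_cmult mult_bound_exp U)
    then show ?thesis by (simp add: e w exp_minus norm_inverse)
  qed
  have DE: "mult_bound (\<lambda>\<xi>. of_real (?S N) * (of_real (exp (- w N)) * (D \<xi> * (exp (of_real (w N) * U N \<xi>) - 1))))
     (cmod (of_real (?S N)) * (cmod (of_real (exp (- w N))) * ((exp (w N) - 1) * L N)))"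
    by (intro mult_bound_cmult mult_bound_exp_minus_1 U D w)
  \<comment> \<open>The probability \<open>1 - exp (- w N)\<close> of some jump from source
    \<open>N\<close> is estimated by 1.\<close>
  have DE': "mult_bound (\<lambda>\<xi>. of_real (?S N) * (of_real (exp (- w N)) * (D \<xi> * (exp (of_real (w N) * U N \<xi>) - 1)))) (?S N * L N)"
    by (rule mult_bound_mono[OF DE])
      (use mult_bound_nonneg[OF D, of N] in \<open>auto simp: exp_minus field_simps norm_divide\<close>)
  \<comment> \<open>Telescoping: a jump occurred before source \<open>N\<close>, and then factor
    \<open>N\<close> is a contraction; or none did, and source \<open>N\<close> must supply
    one.\<close>
  have "mult_bound (\<lambda>\<xi>. (D \<xi> * ((\<Prod>n<N. ?E n \<xi>) - of_real (?S N))) * ?E N \<xi> +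
     of_real (?S N) * (of_real (exp (- w N)) * (D \<xi> * (exp (of_real (w N) * U N \<xi>) - 1))))
     ((\<Sum>n<N. ?S n * L n) * 1 + ?S N * L N)"
    by (intro mult_bound_add mult_bound_mult Suc E DE')
  also have "(\<lambda>\<xi>. (D \<xi> * ((\<Prod>n<N. ?E n \<xi>) - of_real (?S N))) * ?E N \<xi> +
     of_real (?S N) * (of_real (exp (- w N)) * (D \<xi> * (exp (of_real (w N) * U N \<xi>) - 1))))
     = (\<lambda>\<xi>. D \<xi> * ((\<Prod>n<Suc N. ?E n \<xi>) - of_real (?S (Suc N))))"
    by (rule ext) (simp add: e exp_diff exp_minus exp_add algebra_simps divide_inverse exp_of_real)
  finally show ?case by simp
qed

section \<open>Exponents of Levy densities\<close>

lemma norm_one_minus_cis: "cmod (1 - cis x) \<le> 2"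
  by (rule order_trans[OF norm_triangle_ineq4]) simp

text \<open>This second-order Taylor remainder serves twice: for integrability at small jumps and
  for the convergence of difference quotients.\<close>

lemma norm_one_minus_cis_compensated: "cmod (1 - cis x + \<i> * of_real x) \<le> x\<^sup>2 / 2"
proof -
  have "cmod (iexp x - (\<Sum>k\<le>1. (\<i> * x)^k / fact k)) \<le> \<bar>x\<bar>^(Suc 1) / fact (Suc 1)"
    by (rule iexp_approx1)
  then have "cmod (cis x - 1 - \<i> * of_real x) \<le> x\<^sup>2 / 2"
    by (simp add: cis_conv_exp numeral_2_eq_2 algebra_simps)
  then show ?thesis
    by (subst norm_minus_cancel[symmetric]) (simp add: algebra_simps)
qed

definition levy_integrand :: "'a::euclidean_space \<Rightarrow> 'a \<Rightarrow> complex" where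
  "levy_integrand \<xi> h = 1 - cis (\<xi> \<bullet> h) + \<i> * complex_of_real (\<xi> \<bullet> h) * complex_of_real (indicator (cball 0 1) h)"

lemma levy_integrand_measurable [measurable]: "levy_integrand \<xi> \<in> borel_measurable borel"
proof -
  have [measurable]: "(\<lambda>h. cis (\<xi> \<bullet> h)) \<in> borel_measurable borel"
    by (intro borel_measurable_continuous_onI continuous_intros)
  have [measurable]: "cball (0::'a) 1 \<in> sets borel" by simp
  show ?thesis unfolding levy_integrand_def by measurable
qed

lemma norm_levy_integrand_le:
  fixes \<xi> h :: "'a::euclidean_space"
  shows "cmod (levy_integrand \<xi> h) \<le> (2 + (norm \<xi>)\<^sup>2) * min 1 ((norm h)\<^sup>2)"
proof (cases "norm h \<le> 1")
  case True
  then have "cmod (levy_integrand \<xi> h) \<le> (\<xi> \<bullet> h)\<^sup>2 / 2"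
    using norm_one_minus_cis_compensated[of "\<xi> \<bullet> h"] by (simp add: levy_integrand_def indicator_def dist_norm)
  also have "\<dots> \<le> (norm \<xi> * norm h)\<^sup>2"
    using Cauchy_Schwarz_ineq2[of \<xi> h] abs_le_square_iff[of "\<xi> \<bullet> h" "norm \<xi> * norm h"]
      zero_le_power2[of "norm \<xi> * norm h"] by (smt (verit) divide_le_eq field_sum_of_halves norm_ge_zero mult_nonneg_nonneg)
  also have "\<dots> = (norm \<xi>)\<^sup>2 * min 1 ((norm h)\<^sup>2)"
    using True by (simp add: power_mult_distrib min_absorb2 abs_square_le_1)
  also have "\<dots> \<le> (2 + (norm \<xi>)\<^sup>2) * min 1 ((norm h)\<^sup>2)"
    by (intro mult_right_mono) auto
  finally show ?thesis .
next
  case False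
  then have "min 1 ((norm h)\<^sup>2) = 1" by (simp add: min_def one_le_power)
  then show ?thesis using False norm_one_minus_cis[of "\<xi> \<bullet> h"]
    by (simp add: levy_integrand_def indicator_def dist_norm add_increasing2)
qed

definition levy_density :: "('a::euclidean_space \<Rightarrow> real) \<Rightarrow> bool" where
  "levy_density g \<longleftrightarrow> g \<in> borel_measurable borel \<and> (\<forall>h. 0 \<le> g h) \<and>
     integrable lborel (\<lambda>h. g h * min 1 ((norm h)\<^sup>2))"

definition density_exponent :: "('a::euclidean_space \<Rightarrow> real) \<Rightarrow> 'a \<Rightarrow> complex" where
  "density_exponent g \<xi> = (LINT h|lborel. g h *\<^sub>R levy_integrand \<xi> h)"

lemma levy_densityD:
  assumes "levy_density g"
  shows "g \<in> borel_measurable borel" "0 \<le> g h" "integrable lborel (\<lambda>h. g h * min 1 ((norm h)\<^sup>2))"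
  using assms by (auto simp: levy_density_def)

lemma levy_density_bound:
  assumes g: "levy_density g" and f: "f \<in> borel_measurable borel" and "\<And>h. 0 \<le> f h" "\<And>h. f h \<le> g h"
  shows "levy_density f"
  unfolding levy_density_def
proof safe
  show "integrable lborel (\<lambda>h. f h * min 1 ((norm h)\<^sup>2))"
    by (rule Bochner_Integration.integrable_bound[OF levy_densityD(3)[OF g]])
       (use assms levy_densityD(2)[OF g] in \<open>auto intro!: mult_right_mono simp: abs_mult\<close>)
qed (use assms in auto)

lemma levy_density_cmult:
  assumes g: "levy_density g" and "0 \<le> k"
  shows "levy_density (\<lambda>h. k * g h)"
  using assms by (auto simp: levy_density_def mult.assoc)

lemma integrable_levy_density:
  assumes g: "levy_density g"
  shows "integrable lborel (\<lambda>h. g h *\<^sub>R levy_integrand \<xi> h)"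
proof (rule Bochner_Integration.integrable_bound)
  show "integrable lborel (\<lambda>h. (2 + (norm \<xi>)\<^sup>2) * (g h * min 1 ((norm h)\<^sup>2)))"
    using levy_densityD(3)[OF g] by simp
  show "(\<lambda>h. g h *\<^sub>R levy_integrand \<xi> h) \<in> borel_measurable lborel"
    using levy_densityD(1)[OF g] by measurable
  show "AE h in lborel. norm (g h *\<^sub>R levy_integrand \<xi> h) \<le> norm ((2 + (norm \<xi>)\<^sup>2) * (g h * min 1 ((norm h)\<^sup>2)))"
  proof (rule AE_I2)
    fix h
    show "norm (g h *\<^sub>R levy_integrand \<xi> h) \<le> norm ((2 + (norm \<xi>)\<^sup>2) * (g h * min 1 ((norm h)\<^sup>2)))"
      using mult_left_mono[OF norm_levy_integrand_le levy_densityD(2)[OF g, of h], of \<xi>] levy_densityD(2)[OF g, of h]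
      by (simp add: abs_mult mult_ac)
  qed
qed

lemma integrable_times_compensator:
  fixes g :: "'a::euclidean_space \<Rightarrow> real"
  assumes "integrable lborel g"
  shows "integrable lborel (\<lambda>h. (g h * indicator (cball 0 1) h) *\<^sub>R h)"
  by (rule Bochner_Integration.integrable_bound[OF assms])
    (use assms in \<open>auto simp: indicator_def abs_mult mult_left_le\<close>)

text \<open>For a finite jump measure the compensator can be integrated separately. It is linear in
  \<xi>, hence a pure phase after exponentiation.\<close>

lemma density_exponent_integrable:
  assumes g: "integrable lborel g"
  shows "density_exponent g \<xi> = of_real (LINT h|lborel. g h) - (LINT h|lborel. g h *\<^sub>R cis (\<xi> \<bullet> h))
    + \<i> * of_real (\<xi> \<bullet> (LINT h|lborel. (g h * indicator (cball 0 1) h) *\<^sub>R h))"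
proof -
  have i: "integrable lborel (\<lambda>h. g h *\<^sub>R cis (\<xi> \<bullet> h))"
    by (rule Bochner_Integration.integrable_bound[OF g]) (use g in \<open>auto simp: cis_conv_exp\<close>)
  note j = integrable_times_compensator[OF g]
  have "\<xi> \<bullet> (LINT h|lborel. (g h * indicator (cball 0 1) h) *\<^sub>R h) =
      (LINT h|lborel. \<xi> \<bullet> ((g h * indicator (cball 0 1) h) *\<^sub>R h))"
    by (rule integral_inner_right[OF j, symmetric])
  then have "\<i> * of_real (\<xi> \<bullet> (LINT h|lborel. (g h * indicator (cball 0 1) h) *\<^sub>R h)) =
     (LINT h|lborel. \<i> * of_real (\<xi> \<bullet> ((g h * indicator (cball 0 1) h) *\<^sub>R h)))"
    by (simp only: integral_mult_right_zero integral_complex_of_real)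
  moreover have "integrable lborel (\<lambda>h. \<i> * complex_of_real (\<xi> \<bullet> ((g h * indicator (cball 0 1) h) *\<^sub>R h)))"
    using j by (intro integrable_mult_right integrable_of_real integrable_inner_right)
  ultimately have "of_real (LINT h|lborel. g h) - (LINT h|lborel. g h *\<^sub>R cis (\<xi> \<bullet> h))
    + \<i> * of_real (\<xi> \<bullet> (LINT h|lborel. (g h * indicator (cball 0 1) h) *\<^sub>R h))
    = (LINT h|lborel. of_real (g h) - g h *\<^sub>R cis (\<xi> \<bullet> h) + \<i> * of_real (\<xi> \<bullet> ((g h * indicator (cball 0 1) h) *\<^sub>R h)))"
    using i g by (simp del: inner_scaleR_right)
  also have "\<dots> = density_exponent g \<xi>"
    unfolding density_exponent_def levy_integrand_def
    by (intro Bochner_Integration.integral_cong) (auto simp: scaleR_conv_of_real algebra_simps)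
  finally show ?thesis ..
qed

text \<open>Outside the ball of radius \<open>e\<close> the weight
  \<open>min 1 ((norm h)\<^sup>2)\<close> is bounded below by the inverse of
  \<open>max 1 (1 / e\<^sup>2)\<close>.\<close>

lemma integrable_levy_density_truncated:
  assumes g: "levy_density g" and e: "0 < e"
  shows "integrable lborel (\<lambda>h. g h * indicator (- cball 0 e) h)"
proof (rule Bochner_Integration.integrable_bound)
  let ?c = "max 1 (1 / e\<^sup>2)"
  show "integrable lborel (\<lambda>h. ?c * (g h * min 1 ((norm h)\<^sup>2)))"
    using levy_densityD(3)[OF g] by simp
  show "(\<lambda>h. g h * indicator (- cball 0 e) h) \<in> borel_measurable lborel"
    using levy_densityD(1)[OF g] by simp
  show "AE h in lborel. norm (g h * indicator (- cball 0 e) h) \<le> norm (?c * (g h * min 1 ((norm h)\<^sup>2)))"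
  proof (rule AE_I2)
    fix h :: 'a
    have "1 \<le> ?c * min 1 ((norm h)\<^sup>2)" if "norm h > e"
    proof (cases "norm h \<le> 1")
      case True
      have "1 \<le> 1 / e\<^sup>2 * (norm h)\<^sup>2"
        using that e by (simp add: field_simps)
      also have "\<dots> \<le> ?c * (norm h)\<^sup>2" by (intro mult_right_mono) auto
      finally show ?thesis using True by (simp add: min_absorb2 abs_square_le_1)
    next
      case False
      then have "min 1 ((norm h)\<^sup>2) = 1" by (simp add: min_def one_le_power)
      then show ?thesis by simp
    qed
    from mult_left_mono[OF this levy_densityD(2)[OF g, of h]]
    show "norm (g h * indicator (- cball 0 e) h) \<le> norm (?c * (g h * min 1 ((norm h)\<^sup>2)))"
      using levy_densityD(2)[OF g, of h] by (auto simp: indicator_def dist_norm abs_mult mult_ac)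
  qed
qed

text \<open>The multiplier is the characteristic function of an infinitely divisible law, hence a
  contraction. The law is not constructed: jumps below size 1/(n+1) are cut off, which gives a
  shifted compound Poisson law, and the cut-off is then removed. This is needed for the part of the
  jumps left after subtracting the cubes, for which no law is given.\<close>

lemma mult_bound_exp_density_exponent:
  assumes g: "levy_density g"
  shows "mult_bound (\<lambda>\<xi>. exp (- density_exponent g \<xi>)) 1"
proof (rule mult_bound_limit)
  define f where "f n h = g h * indicator (- cball 0 (inverse (real (Suc n)))) h" for n h
  have f: "integrable lborel (f n)" for n
    unfolding f_def using integrable_levy_density_truncated[OF g, of "inverse (real (Suc n))"] by simp
  have fm: "f n \<in> borel_measurable borel" for n using f[of n] by auto
  have f0: "0 \<le> f n h" for n h
    unfolding f_def using levy_densityD(2)[OF g] by simp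
  show "mult_bound (\<lambda>\<xi>. exp (- density_exponent (f n) \<xi>)) 1" for n
  proof -
    define b where "b = (LINT h|lborel. (f n h * indicator (cball 0 1) h) *\<^sub>R h)"
    define w where "w = (LINT h|lborel. f n h)"
    \<comment> \<open>As \<open>f n\<close> is nonnegative, its L1 norm is its total mass
      \<open>w\<close>, and \<open>exp (- w)\<close> cancels \<open>exp w\<close> exactly.\<close>
    have "mult_bound (\<lambda>\<xi>. of_real (exp (- w)) * exp (LINT h|lborel. f n h *\<^sub>R cis (\<xi> \<bullet> h)) * cis (\<xi> \<bullet> (- b)))
       (cmod (of_real (exp (- w))) * exp (LINT h|lborel. \<bar>f n h\<bar>) * 1)"
      by (intro mult_bound_mult mult_bound_const mult_bound_exp mult_bound_fourier f mult_bound_cis)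
    also have "(LINT h|lborel. \<bar>f n h\<bar>) = w" unfolding w_def using f0 by simp
    also have "cmod (of_real (exp (- w))) * exp w * 1 = 1"
      by (simp add: exp_minus norm_inverse)
    also have "(\<lambda>\<xi>. of_real (exp (- w)) * exp (LINT h|lborel. f n h *\<^sub>R cis (\<xi> \<bullet> h)) * cis (\<xi> \<bullet> (- b)))
       = (\<lambda>\<xi>. exp (- density_exponent (f n) \<xi>))"
      by (rule ext) (simp add: density_exponent_integrable[OF f] w_def[symmetric] b_def[symmetric] cis_conv_exp
        exp_of_real[symmetric] exp_add[symmetric] algebra_simps del: exp_of_real)
    finally show ?thesis .
  qed
  show "(\<lambda>n. exp (- density_exponent (f n) \<xi>)) \<longlonglongrightarrow> exp (- density_exponent g \<xi>)" for \<xi>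
  proof -
    have "(\<lambda>n. density_exponent (f n) \<xi>) \<longlonglongrightarrow> density_exponent g \<xi>"
      unfolding density_exponent_def
    proof (rule integral_dominated_convergence)
      show "integrable lborel (\<lambda>h. norm (g h *\<^sub>R levy_integrand \<xi> h))"
        by (rule integrable_norm[OF integrable_levy_density[OF g]])
      show "AE h in lborel. (\<lambda>n. f n h *\<^sub>R levy_integrand \<xi> h) \<longlonglongrightarrow> g h *\<^sub>R levy_integrand \<xi> h"
      proof (rule AE_I2)
        fix h
        show "(\<lambda>n. f n h *\<^sub>R levy_integrand \<xi> h) \<longlonglongrightarrow> g h *\<^sub>R levy_integrand \<xi> h"
        \<comment> \<open>The truncations never reach the origin, but the integrand vanishes
          there.\<close>
        proof (cases "h = 0")
          case True
          then show ?thesis by (simp add: levy_integrand_def)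
        next
          case False
          then have "eventually (\<lambda>n. inverse (real (Suc n)) < norm h) sequentially"
            by (intro order_tendstoD(2)[OF LIMSEQ_inverse_real_of_nat]) simp
          then have "eventually (\<lambda>n. f n h *\<^sub>R levy_integrand \<xi> h = g h *\<^sub>R levy_integrand \<xi> h) sequentially"
            by eventually_elim (simp add: f_def)
          then show ?thesis by (rule tendsto_eventually)
        qed
      qed
      show "AE h in lborel. norm (f n h *\<^sub>R levy_integrand \<xi> h) \<le> norm (g h *\<^sub>R levy_integrand \<xi> h)" for n
        by (simp add: f_def indicator_def)
      show "(\<lambda>h. f n h *\<^sub>R levy_integrand \<xi> h) \<in> borel_measurable lborel" for n
        using fm[of n] by measurable
      show "(\<lambda>h. g h *\<^sub>R levy_integrand \<xi> h) \<in> borel_measurable lborel"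
        using levy_densityD(1)[OF g] by measurable
    qed
    then show ?thesis by (intro tendsto_intros)
  qed
qed

section \<open>Uniform jumps in a cube\<close>

lemma integral_abs_indicator_diff:
  fixes A B :: "'a::euclidean_space set"
  assumes "A \<in> fmeasurable lborel" "B \<in> fmeasurable lborel" "B \<subseteq> A"
  shows "(LINT h|lborel. \<bar>indicator A h - indicator B h :: real\<bar>) = measure lborel A - measure lborel B"
proof -
  have "(LINT h|lborel. \<bar>indicator A h - indicator B h :: real\<bar>) = (LINT h|lborel. indicator A h - indicator B h)"
    using assms(3) by (intro Bochner_Integration.integral_cong) (auto simp: indicator_def)
  also have "\<dots> = measure lborel A - measure lborel B"
    using assms by (subst Bochner_Integration.integral_diff) (auto simp: fmeasurable_def)
  finally show ?thesis .
qed

text \<open>The two cubes overlap in a box that is shorter by \<open>\<epsilon>\<close> in the direction \<open>b\<close>.\<close>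

lemma integral_abs_cube_shift_le:
  fixes b :: "'a::euclidean_space"
  assumes b: "b \<in> Basis" and \<epsilon>: "0 \<le> \<epsilon>" "\<epsilon> \<le> \<rho>"
  defines "Q \<equiv> box (\<rho> *\<^sub>R One) ((2 * \<rho>) *\<^sub>R One) :: 'a set"
    and "Q' \<equiv> box (\<rho> *\<^sub>R One + \<epsilon> *\<^sub>R b) ((2 * \<rho>) *\<^sub>R One + \<epsilon> *\<^sub>R b) :: 'a set"
  shows "(LINT h|lborel. \<bar>indicator Q' h - indicator Q h :: real\<bar>) \<le> 2 * (\<epsilon> * \<rho> ^ (DIM('a) - 1))"
proof -
  define I where "I = box (\<rho> *\<^sub>R One + \<epsilon> *\<^sub>R b) ((2 * \<rho>) *\<^sub>R One)"
  have \<rho>: "0 \<le> \<rho>" using \<epsilon> by linarith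
  have prod: "(\<Prod>i\<in>Basis. if i = b then x else \<rho>) = x * \<rho> ^ (DIM('a) - 1)" for x
  proof -
    have "(\<Prod>i\<in>Basis. if i = b then x else \<rho>) = x * (\<Prod>i\<in>Basis - {b}. if i = b then x else \<rho>)"
      using b by (subst prod.remove[of _ b]) auto
    also have "(\<Prod>i\<in>Basis - {b}. if i = b then x else \<rho>) = (\<Prod>i\<in>Basis - {b}. \<rho>)"
      by (intro prod.cong) auto
    finally show ?thesis using b by simp
  qed
  have ib: "b \<bullet> i = (if i = b then 1 else 0)" if "i \<in> Basis" for i
    using that b by (auto simp: inner_Basis)
  have mQ: "measure lborel Q = \<rho> * \<rho> ^ (DIM('a) - 1)"
    unfolding Q_def using \<rho> by (subst prod[symmetric], subst measure_lborel_box_eq)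
      (auto simp: inner_diff_left intro!: prod.cong)
  have mQ': "measure lborel Q' = \<rho> * \<rho> ^ (DIM('a) - 1)"
    unfolding Q'_def using \<rho> by (subst prod[symmetric], subst measure_lborel_box_eq)
      (auto simp: inner_diff_left inner_add_left intro!: prod.cong)
  have mI: "measure lborel I = (\<rho> - \<epsilon>) * \<rho> ^ (DIM('a) - 1)"
    unfolding I_def using \<epsilon> \<rho> by (subst prod[symmetric], subst measure_lborel_box_eq)
      (auto simp: inner_diff_left inner_add_left ib intro!: prod.cong)
  have I: "I \<subseteq> Q" "I \<subseteq> Q'"
  proof -
    have "h \<in> Q \<and> h \<in> Q'" if "h \<in> I" for h
    proof -
      have l: "\<rho> + \<epsilon> * (b \<bullet> i) < h \<bullet> i" "h \<bullet> i < 2 * \<rho>" if "i \<in> Basis" for i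
        using \<open>h \<in> I\<close> that by (simp_all add: I_def box_def inner_add_left)
      have e: "0 \<le> \<epsilon> * (b \<bullet> i)" if "i \<in> Basis" for i using ib[OF that] \<epsilon> by simp
      have "\<rho> < h \<bullet> i" "h \<bullet> i < 2 * \<rho> + \<epsilon> * (b \<bullet> i)" if "i \<in> Basis" for i
        using l[OF that] e[OF that] by linarith+
      with l show ?thesis by (simp add: Q_def Q'_def box_def inner_add_left)
    qed
    then show "I \<subseteq> Q" "I \<subseteq> Q'" by auto
  qed
  have fm: "Q \<in> fmeasurable lborel" "Q' \<in> fmeasurable lborel" "I \<in> fmeasurable lborel"
    unfolding I_def Q_def Q'_def by auto
  then have int: "integrable lborel (\<lambda>h. indicator Q h :: real)" "integrable lborel (\<lambda>h. indicator Q' h :: real)"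
     "integrable lborel (\<lambda>h. indicator I h :: real)"
    by (auto simp: fmeasurable_def)
  \<comment> \<open>Triangle inequality through the common part \<open>I\<close>; what remains of
    each cube is a slab of thickness \<epsilon>.\<close>
  have "(LINT h|lborel. \<bar>indicator Q' h - indicator Q h :: real\<bar>)
     \<le> (LINT h|lborel. \<bar>indicator Q' h - indicator I h :: real\<bar> + \<bar>indicator Q h - indicator I h :: real\<bar>)"
    by (rule integral_mono) (use int in \<open>auto\<close>)
  also have "\<dots> = (measure lborel Q' - measure lborel I) + (measure lborel Q - measure lborel I)"
    using int by (simp add: integral_abs_indicator_diff[OF fm(1,3) I(1)] integral_abs_indicator_diff[OF fm(2,3) I(2)])
  also have "\<dots> = 2 * (\<epsilon> * \<rho> ^ (DIM('a) - 1))"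
    unfolding mQ mQ' mI by (simp add: algebra_simps)
  finally show ?thesis .
qed

lemma lborel_integral_translate:
  fixes f :: "'a::euclidean_space \<Rightarrow> 'b::{banach, second_countable_topology}"
  assumes "f \<in> borel_measurable borel"
  shows "(LINT h|lborel. f (c + h)) = (LINT h|lborel. f h)"
  by (subst (2) lborel_distr_plus[of c, symmetric], subst integral_distr) (use assms in auto)

lemma cis_difference_quotient:
  assumes "e \<longlonglongrightarrow> (0::real)" "\<And>n. 0 < e n"
  shows "(\<lambda>n. (cis (a * e n) - 1) / of_real (e n)) \<longlonglongrightarrow> \<i> * of_real a"
proof -
  have "(\<lambda>n. (cis (a * e n) - 1) / of_real (e n) - \<i> * of_real a) \<longlonglongrightarrow> 0"
  proof (rule Lim_null_comparison)
    show "(\<lambda>n. a\<^sup>2 / 2 * e n) \<longlonglongrightarrow> 0" using tendsto_mult_right_zero[OF assms(1)] by simp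
    have "cmod ((cis (a * e n) - 1) / of_real (e n) - \<i> * of_real a) \<le> a\<^sup>2 / 2 * e n" for n
    proof -
      have "(cis (a * e n) - 1) / of_real (e n) - \<i> * of_real a = - (1 - cis (a * e n) + \<i> * of_real (a * e n)) / of_real (e n)"
        using assms(2)[of n] by (simp add: field_simps)
      then have "cmod ((cis (a * e n) - 1) / of_real (e n) - \<i> * of_real a) = cmod (1 - cis (a * e n) + \<i> * of_real (a * e n)) / e n"
        using assms(2)[of n] by (simp only: norm_divide norm_minus_cancel norm_of_real abs_of_pos)
      also have "\<dots> \<le> ((a * e n)\<^sup>2 / 2) / e n"
        using norm_one_minus_cis_compensated[of "a * e n"] assms(2)[of n] by (intro divide_right_mono) auto
      also have "\<dots> = a\<^sup>2 / 2 * e n" using assms(2)[of n] by (simp add: power2_eq_square)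
      finally show ?thesis .
    qed
    then show "\<forall>\<^sub>F n in sequentially. norm ((cis (a * e n) - 1) / of_real (e n) - \<i> * of_real a) \<le> a\<^sup>2 / 2 * e n"
      by simp
  qed
  then show ?thesis by (rule LIM_zero_cancel)
qed

text \<open>The cube sits off the origin, all coordinates lying between \<rho> and 2\<rho>. It
  avoids the singularity of the jump density, its points have norm comparable to \<rho>, and halving
  \<rho> yields a disjoint cube.\<close>

definition cube :: "real \<Rightarrow> 'a::euclidean_space set" where
  "cube \<rho> = box (\<rho> *\<^sub>R One) ((2 * \<rho>) *\<^sub>R One)"

definition cube_density :: "real \<Rightarrow> 'a::euclidean_space \<Rightarrow> real" where
  "cube_density \<rho> h = indicator (cube \<rho>) h / \<rho> ^ DIM('a)"

definition cube_fourier :: "real \<Rightarrow> 'a::euclidean_space \<Rightarrow> complex" where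
  "cube_fourier \<rho> \<xi> = (LINT h|lborel. cube_density \<rho> h *\<^sub>R cis (\<xi> \<bullet> h))"

lemma cube_density_nonneg: "0 < \<rho> \<Longrightarrow> 0 \<le> cube_density \<rho> h"
  by (simp add: cube_density_def)

lemma integrable_cube_density: "integrable lborel (cube_density \<rho> :: 'a::euclidean_space \<Rightarrow> real)"
  using emeasure_lborel_box_finite[of "\<rho> *\<^sub>R One" "(2 * \<rho>) *\<^sub>R One :: 'a"]
  unfolding cube_density_def[abs_def] cube_def by (intro integrable_divide) simp

lemma cube_density_measurable [measurable]: "cube_density \<rho> \<in> borel_measurable borel"
  using integrable_cube_density borel_measurable_integrable by fastforce

lemma integral_cube_density:
  assumes "0 < \<rho>"
  shows "(LINT h|lborel. cube_density \<rho> (h::'a::euclidean_space)) = 1"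
proof -
  have "measure lborel (cube \<rho> :: 'a set) = \<rho> ^ DIM('a)"
    unfolding cube_def using assms by (subst measure_lborel_box_eq) (auto simp: inner_diff_left)
  then show ?thesis unfolding cube_density_def using assms by (simp add: cube_def)
qed

lemma mult_bound_cube_fourier:
  assumes "0 < \<rho>"
  shows "mult_bound (cube_fourier \<rho>) 1"
proof -
  have "(LINT h|lborel. \<bar>cube_density \<rho> (h::'a)\<bar>) = (LINT h|lborel. cube_density \<rho> (h::'a))"
    by (simp only: abs_of_nonneg[OF cube_density_nonneg[OF assms]])
  then show ?thesis
    using mult_bound_fourier[OF integrable_cube_density[of \<rho>, where 'a='a]] integral_cube_density[OF assms, where 'a='a]
    by (simp add: cube_fourier_def[abs_def])
qed

text \<open>A difference quotient of \<open>f\<close> integrated over a cube is an integral of \<open>f\<close> over the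
  symmetric difference of two cubes, so no derivative of \<open>f\<close> enters the bound.\<close>

lemma mult_bound_derivative_cube_fourier:
  fixes b :: "'a::euclidean_space"
  assumes b: "b \<in> Basis" and \<rho>: "0 < \<rho>"
  shows "mult_bound (\<lambda>\<xi>. \<i> * of_real (\<xi> \<bullet> b) * cube_fourier \<rho> \<xi>) (2 / \<rho>)"
proof (rule mult_bound_limit)
  \<comment> \<open>Steps at most \<rho>, so that the cube and its shift fit
    \<open>integral_abs_cube_shift_le\<close>.\<close>
  define e where "e n = \<rho> * inverse (real (Suc n))" for n
  have e0: "0 < e n" for n using \<rho> by (simp add: e_def)
  have e1: "e n \<le> \<rho>" for n using \<rho> by (simp add: e_def field_simps)
  have elim: "e \<longlonglongrightarrow> 0"
    unfolding e_def by (intro tendsto_mult_right_zero LIMSEQ_inverse_real_of_nat)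
  show "(\<lambda>n. (cis ((\<xi> \<bullet> b) * e n) - 1) / of_real (e n) * cube_fourier \<rho> \<xi>) \<longlonglongrightarrow> \<i> * of_real (\<xi> \<bullet> b) * cube_fourier \<rho> \<xi>" for \<xi>
    by (intro tendsto_mult cis_difference_quotient tendsto_const elim e0)
  show "mult_bound (\<lambda>\<xi>. (cis ((\<xi> \<bullet> b) * e n) - 1) / of_real (e n) * cube_fourier \<rho> \<xi>) (2 / \<rho>)" for n
  proof -
    let ?d = "cube_density \<rho> :: 'a \<Rightarrow> real"
    \<comment> \<open>The difference quotient is moved from the exponential onto the uniform
      density; only the L1 norm of \<open>g\<close> then matters.\<close>
    define g where "g h = (?d (h - e n *\<^sub>R b) - ?d h) / e n" for h
    have sh: "integrable lborel (\<lambda>h. ?d (h - e n *\<^sub>R b))"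
      using integrable_cube_density[of \<rho>, where 'a='a]
      by (subst (asm) lborel_distr_plus[of "- (e n *\<^sub>R b)", symmetric], subst (asm) integrable_distr_eq)
        (auto simp: algebra_simps)
    then have g: "integrable lborel g"
      unfolding g_def by (intro integrable_divide Bochner_Integration.integrable_diff integrable_cube_density)
    have ic: "integrable lborel (\<lambda>h. f h *\<^sub>R cis (\<xi> \<bullet> h))" if "integrable lborel f" for f and \<xi> :: 'a
      by (rule Bochner_Integration.integrable_bound[OF that]) (use that in \<open>auto simp: cis_conv_exp\<close>)
    have "(LINT h|lborel. g h *\<^sub>R cis (\<xi> \<bullet> h)) = (cis ((\<xi> \<bullet> b) * e n) - 1) / of_real (e n) * cube_fourier \<rho> \<xi>" for \<xi>
    proof -
      have "(LINT h|lborel. ?d (h - e n *\<^sub>R b) *\<^sub>R cis (\<xi> \<bullet> h)) = (LINT h|lborel. ?d h *\<^sub>R cis (\<xi> \<bullet> (e n *\<^sub>R b + h)))"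
        using lborel_integral_translate[of "\<lambda>h. ?d (h - e n *\<^sub>R b) *\<^sub>R cis (\<xi> \<bullet> h)" "e n *\<^sub>R b"] ic[OF sh, of \<xi>]
        by simp
      also have "\<dots> = (LINT h|lborel. cis ((\<xi> \<bullet> b) * e n) * (?d h *\<^sub>R cis (\<xi> \<bullet> h)))"
        by (intro Bochner_Integration.integral_cong) (auto simp: inner_add_right cis_mult[symmetric] mult_ac)
      also have "\<dots> = cis ((\<xi> \<bullet> b) * e n) * cube_fourier \<rho> \<xi>"
        unfolding cube_fourier_def by (rule integral_mult_right_zero)
      finally have 1: "(LINT h|lborel. ?d (h - e n *\<^sub>R b) *\<^sub>R cis (\<xi> \<bullet> h)) = cis ((\<xi> \<bullet> b) * e n) * cube_fourier \<rho> \<xi>" .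
      have "(LINT h|lborel. g h *\<^sub>R cis (\<xi> \<bullet> h)) =
        (LINT h|lborel. (?d (h - e n *\<^sub>R b) *\<^sub>R cis (\<xi> \<bullet> h) - ?d h *\<^sub>R cis (\<xi> \<bullet> h)) / of_real (e n))"
        by (intro Bochner_Integration.integral_cong) (auto simp: g_def scaleR_conv_of_real field_simps)
      also have "\<dots> = (cis ((\<xi> \<bullet> b) * e n) * cube_fourier \<rho> \<xi> - cube_fourier \<rho> \<xi>) / of_real (e n)"
        using ic[OF sh, of \<xi>] ic[OF integrable_cube_density[of \<rho>], of \<xi>] 1
        by (simp add: cube_fourier_def)
      finally show ?thesis by (simp add: field_simps)
    qed
    moreover have "(LINT h|lborel. \<bar>g h\<bar>) \<le> 2 / \<rho>"
    proof -
      let ?Q = "cube \<rho> :: 'a set"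
      let ?Q' = "box (\<rho> *\<^sub>R One + e n *\<^sub>R b) ((2 * \<rho>) *\<^sub>R One + e n *\<^sub>R b)"
      have "h - e n *\<^sub>R b \<in> ?Q \<longleftrightarrow> h \<in> ?Q'" for h
        by (auto simp: cube_def box_def inner_diff_left inner_add_left algebra_simps)
      then have "(LINT h|lborel. \<bar>g h\<bar>) = (LINT h|lborel. \<bar>indicator ?Q' h - indicator ?Q h\<bar> / (\<rho> ^ DIM('a) * e n))"
        using \<rho> e0[of n] by (intro Bochner_Integration.integral_cong)
         (auto simp: g_def cube_density_def indicator_def)
      also have "\<dots> = (LINT h|lborel. \<bar>indicator ?Q' h - indicator ?Q h\<bar>) / (\<rho> ^ DIM('a) * e n)"
        by simp
      also have "\<dots> \<le> (2 * (e n * \<rho> ^ (DIM('a) - 1))) / (\<rho> ^ DIM('a) * e n)"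
        unfolding cube_def using \<rho> e0[of n] e1[of n] b
        by (intro divide_right_mono integral_abs_cube_shift_le) auto
      also have "\<rho> ^ DIM('a) = \<rho> * \<rho> ^ (DIM('a) - 1)"
        by (metis DIM_positive Suc_diff_1 power_Suc)
      also have "(2 * (e n * \<rho> ^ (DIM('a) - 1))) / (\<rho> * \<rho> ^ (DIM('a) - 1) * e n) = 2 / \<rho>"
        using \<rho> e0[of n] by (simp add: field_simps)
      finally show ?thesis .
    qed
    ultimately show ?thesis
      using mult_bound_mono[OF mult_bound_fourier[OF g]] by simp
  qed
qed

section \<open>Splitting off jumps in dyadic cubes\<close>

lemma density_exponent_add:
  assumes "levy_density f" "levy_density g"
  shows "density_exponent (\<lambda>h. f h + g h) \<xi> = density_exponent f \<xi> + density_exponent g \<xi>"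
  unfolding density_exponent_def using integrable_levy_density[OF assms(1)] integrable_levy_density[OF assms(2)]
  by (simp add: scaleR_add_left)

lemma density_exponent_cmult:
  "density_exponent (\<lambda>h. k * g h) \<xi> = of_real k * density_exponent g \<xi>"
  by (simp add: density_exponent_def scaleR_conv_of_real mult.assoc)

text \<open>What matters about \<beta> is that it is chosen before \<xi>: the last term is then a
  translation, whatever the size of \<beta>.\<close>

lemma density_exponent_cubes:
  fixes w \<rho> :: "nat \<Rightarrow> real"
  assumes "\<And>n. 0 < \<rho> n"
  shows "\<exists>\<beta>. \<forall>\<xi>::'a::euclidean_space. density_exponent (\<lambda>h. \<Sum>n<N. w n * cube_density (\<rho> n) h) \<xi>
     = (\<Sum>n<N. of_real (w n) * (1 - cube_fourier (\<rho> n) \<xi>)) + \<i> * of_real (\<xi> \<bullet> \<beta>)"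
proof -
  let ?G = "\<lambda>h::'a. \<Sum>n<N. w n * cube_density (\<rho> n) h"
  have i: "integrable lborel (\<lambda>h::'a. w n * cube_density (\<rho> n) h)" for n
    by (intro integrable_mult_right integrable_cube_density)
  then have G: "integrable lborel ?G" by simp
  have "(LINT h|lborel. ?G h *\<^sub>R cis (\<xi> \<bullet> h)) = (\<Sum>n<N. of_real (w n) * cube_fourier (\<rho> n) \<xi>)" for \<xi> :: 'a
  proof -
    have j: "integrable lborel (\<lambda>h::'a. cube_density (\<rho> n) h *\<^sub>R cis (\<xi> \<bullet> h))" for n
      by (rule Bochner_Integration.integrable_bound[OF integrable_cube_density[of "\<rho> n"]]) (auto simp: cis_conv_exp)
    have "(LINT h|lborel. ?G h *\<^sub>R cis (\<xi> \<bullet> h)) = (LINT h|lborel. (\<Sum>n<N. of_real (w n) * (cube_density (\<rho> n) h *\<^sub>R cis (\<xi> \<bullet> h))))"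
      by (intro Bochner_Integration.integral_cong) (simp_all add: scaleR_sum_left scaleR_conv_of_real mult.assoc sum_distrib_right)
    also have "\<dots> = (\<Sum>n<N. of_real (w n) * cube_fourier (\<rho> n) \<xi>)"
      unfolding cube_fourier_def using integrable_mult_right[OF j]
      by (subst Bochner_Integration.integral_sum) (simp_all only: integral_mult_right_zero)
    finally show ?thesis .
  qed
  moreover have "(LINT h|lborel. ?G h) = (\<Sum>n<N. w n)"
    using i by (simp add: integral_cube_density[OF assms])
  moreover have "(\<Sum>n<N. of_real (w n) * (1 - cube_fourier (\<rho> n) \<xi>)) =
      of_real (\<Sum>n<N. w n) - (\<Sum>n<N. of_real (w n) * cube_fourier (\<rho> n) \<xi>)" for \<xi> :: 'a
    by (simp add: right_diff_distrib sum_subtractf)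
  ultimately show ?thesis
    by (intro exI[of _ "LINT h|lborel. (?G h * indicator (cball 0 1) h) *\<^sub>R h"] allI)
      (simp only: density_exponent_integrable[OF G])
qed

text \<open>One coordinate decides: it would lie strictly between \<rho> and 2\<rho> at two scales
  whose ratio is at least 2.\<close>

lemma cubes_disjoint:
  fixes \<rho> :: "nat \<Rightarrow> real"
  assumes dec: "\<And>n. 2 * \<rho> (Suc n) \<le> \<rho> n" and pos: "\<And>n. 0 < \<rho> n"
    and h: "h \<in> cube (\<rho> n)" "h \<in> (cube (\<rho> m) :: 'a::euclidean_space set)"
  shows "n = m"
proof (rule ccontr)
  assume "n \<noteq> m"
  have *: False if lt: "n < m" and h: "h \<in> cube (\<rho> n)" "h \<in> cube (\<rho> m)" for n m
  proof -
    have "decseq \<rho>"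
      unfolding decseq_Suc_iff
    proof
      fix n show "\<rho> (Suc n) \<le> \<rho> n" using dec[of n] pos[of "Suc n"] by linarith
    qed
    then have "\<rho> m \<le> \<rho> (Suc n)" using lt by (auto simp: decseq_def)
    then have "2 * \<rho> m \<le> \<rho> n" using dec[of n] by linarith
    moreover obtain b :: 'a where b: "b \<in> Basis" using nonempty_Basis by blast
    ultimately show False using h by (auto simp: cube_def box_def dest!: bspec[OF _ b])
  qed
  show False using \<open>n \<noteq> m\<close> *[of n m] *[of m n] h by linarith
qed

text \<open>By disjointness at most one summand is nonzero at a given \<open>h\<close>, so the lower
  bounds on the single cubes do not add up.\<close>

lemma sum_cube_densities_le:
  fixes \<rho> w :: "nat \<Rightarrow> real" and g :: "'a::euclidean_space \<Rightarrow> real"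
  assumes dec: "\<And>n. 2 * \<rho> (Suc n) \<le> \<rho> n" and pos: "\<And>n. 0 < \<rho> n"
    and g: "\<And>h. 0 \<le> g h" and lower: "\<And>n h. h \<in> cube (\<rho> n) \<Longrightarrow> w n / \<rho> n ^ DIM('a) \<le> g h"
  shows "(\<Sum>n<N. w n * cube_density (\<rho> n) h) \<le> g h"
proof (cases "\<exists>m<N. h \<in> cube (\<rho> m)")
  case True
  then obtain m where m: "m < N" "h \<in> cube (\<rho> m)" by blast
  have "cube_density (\<rho> n) h = 0" if "n \<noteq> m" for n
  proof -
    have "h \<notin> cube (\<rho> n)" using that cubes_disjoint[of \<rho>, OF dec pos m(2), of n] by blast
    then show ?thesis by (simp add: cube_density_def)
  qed
  then have "(\<Sum>n<N. w n * cube_density (\<rho> n) h) = (\<Sum>n\<in>{m}. w n * cube_density (\<rho> n) h)"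
    by (intro sum.mono_neutral_right) (use m(1) in simp_all)
  also have "\<dots> \<le> g h" using lower[OF m(2)] m(2) by (simp add: cube_density_def)
  finally show ?thesis .
next
  case False
  then have "(\<Sum>n<N. w n * cube_density (\<rho> n) h) = 0"
    by (intro sum.neutral) (auto simp: cube_density_def)
  then show ?thesis using g by simp
qed

text \<open>Splitting off the jumps that are uniform on the first \<open>N\<close> cubes, the derivative falls on the
  first cube in which a jump occurs. The event that no jump occurs contributes the remainder, which
  vanishes as \<open>N\<close> grows.\<close>

lemma mult_bound_derivative_exp_density_exponent:
  fixes \<rho> w :: "nat \<Rightarrow> real" and g :: "'a::euclidean_space \<Rightarrow> real"
  assumes dec: "\<And>n. 2 * \<rho> (Suc n) \<le> \<rho> n" and pos: "\<And>n. 0 < \<rho> n" and w: "\<And>n. 0 \<le> w n"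
    and g: "levy_density g" and lower: "\<And>n h. h \<in> cube (\<rho> n) \<Longrightarrow> w n / \<rho> n ^ DIM('a) \<le> g h"
    and b: "b \<in> Basis" and summ: "summable (\<lambda>n. exp (- (\<Sum>m<n. w m)) * (2 / \<rho> n))"
  shows "mult_bound (\<lambda>\<xi>. \<i> * of_real (\<xi> \<bullet> b) * exp (- density_exponent g \<xi>))
     (\<Sum>n. exp (- (\<Sum>m<n. w m)) * (2 / \<rho> n))" (is "mult_bound _ ?K")
proof -
  define G where "G N h = (\<Sum>n<N. w n * cube_density (\<rho> n) h)" for N and h :: 'a
  define R where "R N h = g h - G N h" for N h
  define E where "E N \<xi> = (\<Prod>n<N. exp (of_real (w n) * (cube_fourier (\<rho> n) \<xi> - 1)))" for N and \<xi> :: 'a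
  define S where "S N = exp (- (\<Sum>n<N. w n))" for N
  have Gm: "G N \<in> borel_measurable borel" for N unfolding G_def[abs_def] by simp
  have Gle: "G N h \<le> g h" for N h
    unfolding G_def using levy_densityD(2)[OF g] by (intro sum_cube_densities_le[where \<rho>=\<rho>] dec pos lower) auto
  have G0: "0 \<le> G N h" for N h
    unfolding G_def by (intro sum_nonneg mult_nonneg_nonneg w cube_density_nonneg pos)
  have LG: "levy_density (G N)" for N by (rule levy_density_bound[OF g Gm G0 Gle])
  have LR: "levy_density (R N)" for N
    by (rule levy_density_bound[OF g]) (use Gm[of N] levy_densityD(1)[OF g] G0 Gle in \<open>auto simp: R_def[abs_def]\<close>)
  have "\<forall>N. \<exists>\<beta>. \<forall>\<xi>. density_exponent (G N) \<xi> = (\<Sum>n<N. of_real (w n) * (1 - cube_fourier (\<rho> n) \<xi>)) + \<i> * of_real (\<xi> \<bullet> \<beta>)"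
    unfolding G_def[abs_def] using density_exponent_cubes[where \<rho>=\<rho> and w=w, OF pos] by blast
  then obtain \<beta> where \<beta>: "density_exponent (G N) \<xi> = (\<Sum>n<N. of_real (w n) * (1 - cube_fourier (\<rho> n) \<xi>)) + \<i> * of_real (\<xi> \<bullet> \<beta> N)" for N \<xi>
    by metis
  define T where "T N \<xi> = exp (- density_exponent (R N) \<xi>) * cis (\<xi> \<bullet> (- \<beta> N))" for N \<xi>
  have T: "mult_bound (T N) 1" for N
    using mult_bound_mult[OF mult_bound_exp_density_exponent[OF LR] mult_bound_cis, of N "- \<beta> N"] unfolding T_def by simp
  have split: "exp (- density_exponent g \<xi>) = E N \<xi> * T N \<xi>" for N \<xi>
  proof -
    define A where "A = (\<Sum>n<N. of_real (w n) * (1 - cube_fourier (\<rho> n) \<xi>))"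
    have "density_exponent g \<xi> = A + \<i> * of_real (\<xi> \<bullet> \<beta> N) + density_exponent (R N) \<xi>"
      using density_exponent_add[OF LG LR, of N N \<xi>] unfolding A_def \<beta>[symmetric] by (simp add: R_def[abs_def])
    moreover have "E N \<xi> = exp (- A)"
    proof -
      have "exp (of_real (w n) * (cube_fourier (\<rho> n) \<xi> - 1)) = exp (- (of_real (w n) * (1 - cube_fourier (\<rho> n) \<xi>)))" for n
        by (simp add: algebra_simps)
      then show ?thesis unfolding E_def A_def by (simp only: exp_sum[OF finite_lessThan, symmetric] sum_negf)
    qed
    ultimately have "exp (- density_exponent g \<xi>) = E N \<xi> * (exp (- density_exponent (R N) \<xi>) * exp (- (\<i> * of_real (\<xi> \<bullet> \<beta> N))))"
      by (simp add: exp_add[symmetric] algebra_simps)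
    then show ?thesis unfolding T_def by (simp add: cis_conv_exp)
  qed
  \<comment> \<open>The contraction is tested on a single frequency at the origin, which bounds the
    multiplier pointwise.\<close>
  have T1: "cmod (T N \<xi>) \<le> 1" for N \<xi>
    using mult_boundD[OF T[of N], of "{\<xi>}" "\<lambda>_. 1" 1 0] by (simp add: trig_def)
  \<comment> \<open>The terms of the summable series tend to 0, and the factor 2/\<rho> in them is
    bounded below because \<rho> decreases. So the no-jump probability vanishes.\<close>
  have S0: "S \<longlonglongrightarrow> 0"
  proof (rule tendsto_sandwich[OF _ _ tendsto_const])
    show "(\<lambda>n. \<rho> 0 / 2 * (exp (- (\<Sum>m<n. w m)) * (2 / \<rho> n))) \<longlonglongrightarrow> 0"
      by (rule tendsto_mult_right_zero[OF summable_LIMSEQ_zero[OF summ]])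
    have \<rho>0: "\<rho> n \<le> \<rho> 0" for n
    proof (induction n)
      case (Suc n)
      then show ?case using dec[of n] pos[of "Suc n"] by linarith
    qed simp
    have "S n \<le> \<rho> 0 / 2 * (exp (- (\<Sum>m<n. w m)) * (2 / \<rho> n))" for n
    proof -
      have "S n = \<rho> n / 2 * (S n * (2 / \<rho> n))" using pos[of n] by simp
      also have "\<dots> \<le> \<rho> 0 / 2 * (S n * (2 / \<rho> n))"
        using \<rho>0[of n] pos[of n] by (intro mult_right_mono) (auto simp: S_def)
      finally show ?thesis unfolding S_def .
    qed
    then show "\<forall>\<^sub>F n in sequentially. S n \<le> \<rho> 0 / 2 * (exp (- (\<Sum>m<n. w m)) * (2 / \<rho> n))"
      by simp
  qed (simp add: S_def)
  \<comment> \<open>The derivative of the no-jump part \<open>of_real (S N) * T N \<xi>\<close> has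
    no bound, hence it is removed at each finite \<open>N\<close>. For fixed \<xi> it tends to 0, so
    the limit is the full multiplier.\<close>
  define m where "m N \<xi> = \<i> * of_real (\<xi> \<bullet> b) * (E N \<xi> - of_real (S N)) * T N \<xi>" for N \<xi>
  have m1: "mult_bound (m N) ?K" for N
  proof -
    have "mult_bound (\<lambda>\<xi>. \<i> * of_real (\<xi> \<bullet> b) * (E N \<xi> - of_real (S N))) (\<Sum>n<N. exp (- (\<Sum>m<n. w m)) * (2 / \<rho> n))"
      unfolding E_def S_def
      by (intro mult_bound_compound mult_bound_cube_fourier mult_bound_derivative_cube_fourier pos w b)
    from mult_bound_mult[OF this T[of N]] show ?thesis
      unfolding m_def by (rule mult_bound_mono) (simp only: mult_1_right, rule sum_le_suminf[OF summ], use pos in \<open>simp_all add: less_imp_le\<close>)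
  qed
  have m2: "(\<lambda>N. m N \<xi>) \<longlonglongrightarrow> \<i> * of_real (\<xi> \<bullet> b) * exp (- density_exponent g \<xi>)" for \<xi>
  proof -
    have "(\<lambda>N. of_real (S N) * T N \<xi>) \<longlonglongrightarrow> 0"
    proof (rule Lim_null_comparison[OF _ S0])
      show "\<forall>\<^sub>F N in sequentially. norm (of_real (S N) * T N \<xi>) \<le> S N"
        using T1[of _ \<xi>] by (intro always_eventually allI) (simp add: norm_mult S_def mult_left_le)
    qed
    then have "(\<lambda>N. \<i> * of_real (\<xi> \<bullet> b) * (exp (- density_exponent g \<xi>) - of_real (S N) * T N \<xi>))
        \<longlonglongrightarrow> \<i> * of_real (\<xi> \<bullet> b) * (exp (- density_exponent g \<xi>) - 0)"
      by (intro tendsto_intros)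
    moreover have "m N \<xi> = \<i> * of_real (\<xi> \<bullet> b) * (exp (- density_exponent g \<xi>) - of_real (S N) * T N \<xi>)" for N
      unfolding m_def split[of \<xi> N] by (simp add: algebra_simps)
    ultimately show ?thesis by simp
  qed
  from m2 m1 show ?thesis by (rule mult_bound_limit)
qed

section \<open>The Levy density of an admissible order function\<close>

text \<open>The function is dominated by the sum of \<open>B j\<close> times the indicators of the
  balls of radius \<open>R j\<close>. Full balls in place of annuli cost only a constant factor for
  geometric radii.\<close>

lemma integrable_dyadic:
  fixes f :: "'a::euclidean_space \<Rightarrow> real"
  assumes f: "f \<in> borel_measurable borel" and f0: "\<And>h. 0 \<le> f h"
    and B: "\<And>j. 0 \<le> B j" and R: "\<And>j. 0 \<le> R j"
    and cover: "\<And>h. f h \<noteq> 0 \<Longrightarrow> \<exists>j. norm h \<le> R j \<and> f h \<le> B j"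
    and summ: "summable (\<lambda>j::nat. B j * R j ^ DIM('a))"
  shows "integrable lborel f"
proof (rule integrableI_bounded)
  show "f \<in> borel_measurable lborel" using f by simp
  have "(\<integral>\<^sup>+ h. ennreal (norm (f h)) \<partial>lborel) \<le> (\<integral>\<^sup>+ h. (\<Sum>j. ennreal (B j) * indicator (cball (0::'a) (R j)) h) \<partial>lborel)"
  proof (rule nn_integral_mono)
    fix h
    show "ennreal (norm (f h)) \<le> (\<Sum>j. ennreal (B j) * indicator (cball 0 (R j)) h)"
    proof (cases "f h = 0")
      case False
      then obtain j where j: "norm h \<le> R j" "f h \<le> B j" using cover by blast
      have "ennreal (norm (f h)) \<le> ennreal (B j) * indicator (cball 0 (R j)) h"
        using j f0[of h] by (simp add: ennreal_leI)
      also have "\<dots> \<le> (\<Sum>j. ennreal (B j) * indicator (cball 0 (R j)) h)"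
        using sum_le_suminf[of "\<lambda>j. ennreal (B j) * indicator (cball 0 (R j)) h" "{j}"]
        by (simp del: sum_mult_indicator)
      finally show ?thesis .
    qed simp
  qed
  also have "\<dots> = (\<Sum>j. \<integral>\<^sup>+ h. ennreal (B j) * indicator (cball (0::'a) (R j)) h \<partial>lborel)"
    by (rule nn_integral_suminf) (auto intro!: borel_measurable_times_ennreal borel_measurable_indicator)
  also have "\<dots> = (\<Sum>j. ennreal (unit_ball_vol DIM('a) * (B j * R j ^ DIM('a))))"
    by (intro suminf_cong, subst nn_integral_cmult_indicator)
      (auto simp: emeasure_cball R B ennreal_mult'[symmetric] mult_ac)
  also have "(\<Sum>j. ennreal (unit_ball_vol DIM('a) * (B j * R j ^ DIM('a)))) \<noteq> top"
  proof (rule ennreal_suminf_neq_top)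
    show "summable (\<lambda>j. unit_ball_vol DIM('a) * (B j * R j ^ DIM('a)))" by (rule summable_mult[OF summ])
    show "0 \<le> unit_ball_vol DIM('a) * (B j * R j ^ DIM('a))" for j using B[of j] R[of j] by simp
  qed
  then have "(\<Sum>j. ennreal (unit_ball_vol DIM('a) * (B j * R j ^ DIM('a)))) < \<infinity>" by (simp add: less_top)
  finally show "(\<integral>\<^sup>+ h. ennreal (norm (f h)) \<partial>lborel) < \<infinity>" .
qed

lemma dyadic_below_one:
  assumes "0 < x" "x \<le> (1::real)"
  shows "\<exists>j. (1 / 2) ^ Suc j < x \<and> x \<le> (1 / 2) ^ j"
proof -
  define k where "k = (LEAST k. (1 / 2) ^ k < x)"
  have k: "(1 / 2) ^ k < x"
    unfolding k_def using real_arch_pow_inv[OF assms(1), of "1/2"] by (auto intro: LeastI_ex)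
  have "k \<noteq> 0" using k assms(2) by (intro notI) simp
  then obtain j where j: "k = Suc j" using not0_implies_Suc by blast
  have "\<not> (1 / 2) ^ j < x"
    using not_less_Least[of j "\<lambda>k. (1 / 2) ^ k < x"] j unfolding k_def by simp
  then show ?thesis using k j by force
qed

text \<open>The quotient of consecutive terms is \<open>2 * exp (- (c * q ^ n))\<close>, which is at
  most 1/2 as soon as \<open>c * q ^ n\<close> exceeds \<open>ln 4\<close>.\<close>

lemma summable_doubling_exp_geometric:
  assumes c: "0 < c" and q: "1 < (q::real)"
  shows "summable (\<lambda>n. exp (- (\<Sum>m<n. c * q ^ m)) * 2 ^ n)"
proof -
  obtain N where N: "ln 4 / c < q ^ N" using real_arch_pow[OF q] by blast
  show ?thesis
  proof (rule summable_ratio_test[of "1/2" N])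
    fix n assume "N \<le> n"
    then have "ln 4 / c \<le> q ^ n" using power_increasing[of N n q] q N by linarith
    then have "ln 4 \<le> c * q ^ n" using c by (simp add: field_simps)
    then have "exp (ln 4) \<le> exp (c * q ^ n)" by (simp only: exp_le_cancel_iff)
    then have 4: "exp (- (c * q ^ n)) \<le> 1 / 4" by (simp add: exp_minus field_simps)
    have "exp (- (\<Sum>m<Suc n. c * q ^ m)) * 2 ^ Suc n = (2 * exp (- (c * q ^ n))) * (exp (- (\<Sum>m<n. c * q ^ m)) * 2 ^ n)"
      by (simp add: exp_add[symmetric] mult_ac)
    also have "\<dots> \<le> 1 / 2 * (exp (- (\<Sum>m<n. c * q ^ m)) * 2 ^ n)"
      using 4 by (intro mult_right_mono) auto
    finally show "norm (exp (- (\<Sum>m<Suc n. c * q ^ m)) * 2 ^ Suc n) \<le> 1 / 2 * norm (exp (- (\<Sum>m<n. c * q ^ m)) * 2 ^ n)"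
      by simp
  qed simp
qed

section \<open>The inverse of the order function\<close>

lemma admissible_order_continuous:
  assumes "admissible_order \<phi>" "0 < r"
  shows "isCont \<phi> r"
proof -
  have "((deriv ^^ 0) \<phi>) differentiable (at r)"
    using assms unfolding admissible_order_def smooth_pos_def by blast
  then show ?thesis using differentiable_imp_continuous_within by fastforce
qed

text \<open>A chosen preimage is meaningful only if \<open>t\<close> is attained. The lower scaling
  bound, used from 1 up to \<open>l\<close> and from \<open>1 / l\<close> up to 1, puts
  \<open>t\<close> between \<phi>(1/l) and \<phi>(l); continuity does the rest.\<close>

lemma order_inv:
  assumes adm: "admissible_order \<phi>" and t: "0 < t"
  shows "0 < order_inv \<phi> t" "\<phi> (order_inv \<phi> t) = t"
proof -
  obtain \<delta> a where \<delta>: "0 < \<delta>" "0 < a" "\<And>l r. 1 \<le> l \<Longrightarrow> 0 < r \<Longrightarrow> a * l powr (2 * \<delta>) * \<phi> r \<le> \<phi> (l * r)"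
    using adm unfolding admissible_order_def by blast
  have pos: "0 < r \<Longrightarrow> 0 < \<phi> r" for r using adm by (auto simp: admissible_order_def)
  have one: "\<phi> 1 = 1" using adm by (auto simp: admissible_order_def)
  \<comment> \<open>Taking \<open>M\<close> above both \<open>t\<close> and \<open>1 / t\<close>
    serves the two ends of the interval; taking it above \<open>a\<close> makes \<open>l\<close> at
    least 1. By the choice of \<open>l\<close>,
    \<open>a * l powr (2 * \<delta>) = M\<close>.\<close>
  define M where "M = max a (max t (1 / t))"
  define l where "l = (M / a) powr (1 / (2 * \<delta>))"
  have M: "1 \<le> M / a" using \<delta> by (simp add: M_def)
  then have "l powr (2 * \<delta>) = M / a" using \<delta> by (simp add: l_def powr_powr)
  then have "a * l powr (2 * \<delta>) = M" using \<delta> by simp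
  then have l: "t \<le> a * l powr (2 * \<delta>)" "1 / t \<le> a * l powr (2 * \<delta>)" "1 \<le> l"
    using M \<delta> by (auto simp: M_def l_def intro: ge_one_powr_ge_zero)
  have "t \<le> \<phi> l" using \<delta>(3)[of l 1] l one by simp
  moreover have "\<phi> (1 / l) \<le> t"
  proof -
    have "1 / t * \<phi> (1 / l) \<le> a * l powr (2 * \<delta>) * \<phi> (1 / l)"
      using l pos[of "1 / l"] by (intro mult_right_mono) auto
    also have "\<dots> \<le> 1" using \<delta>(3)[of l "1 / l"] l one by simp
    finally show ?thesis using t by (simp add: field_simps)
  qed
  moreover have "1 / l \<le> l" using l(3) order_trans[of "1 / l" 1 l] by (simp add: divide_le_eq_1)
  ultimately have "\<exists>r\<ge>1 / l. r \<le> l \<and> \<phi> r = t"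
    using l(3) by (intro IVT) (auto intro!: admissible_order_continuous[OF adm] dest: order_trans[of _ "1/l"] simp: less_le_trans[of 0 "1 / l"])
  then obtain r where "1 / l \<le> r" "\<phi> r = t" by blast
  moreover then have "0 < r" using l(3) by (intro less_le_trans[of 0 "1 / l" r]) auto
  ultimately have "t \<in> \<phi> ` {0<..}" by force
  then show "0 < order_inv \<phi> t" "\<phi> (order_inv \<phi> t) = t"
    unfolding order_inv_def using inv_into_into[of t \<phi> "{0<..}"] by (auto intro: f_inv_into_f)
qed

text \<open>At \<open>h = 0\<close> the denominator and hence the value is 0, whatever
  \<open>a0 0\<close> is, so bounds on \<open>a0\<close> off the origin give nonnegativity
  everywhere.\<close>

definition jump_density :: "('a::euclidean_space \<Rightarrow> real) \<Rightarrow> (real \<Rightarrow> real) \<Rightarrow> 'a \<Rightarrow> real" where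
  "jump_density a0 \<phi> h = a0 h / (norm h ^ DIM('a) * \<phi> (norm h))"

context
  fixes \<phi> :: "real \<Rightarrow> real"
    and a0 :: "'a::euclidean_space \<Rightarrow> real"
    and \<Lambda>1 \<Lambda>2 :: real
  assumes adm: "admissible_order \<phi>"
    and \<Lambda>1: "0 < \<Lambda>1"
    and a0_meas: "a0 \<in> borel_measurable borel"
    and a0_bounds: "\<And>h. h \<noteq> 0 \<Longrightarrow> a0 h \<in> {\<Lambda>1..\<Lambda>2}"
begin

lemma order_pos: "0 < r \<Longrightarrow> 0 < \<phi> r"
  using adm by (auto simp: admissible_order_def)

lemma jump_density_nonneg: "0 \<le> jump_density a0 \<phi> h"
proof (cases "h = 0")
  case False
  then show ?thesis using a0_bounds[of h] order_pos[of "norm h"] \<Lambda>1 by (simp add: jump_density_def)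
qed (simp add: jump_density_def zero_power)

text \<open>Continuity of \<phi> is known on the positive half-line only. Replacing \<phi>(|h|) by 0
  at the origin changes nothing, as the denominator already vanishes there.\<close>

lemma jump_density_measurable: "jump_density a0 \<phi> \<in> borel_measurable borel"
proof -
  have "continuous_on {0<..} \<phi>"
    by (intro continuous_at_imp_continuous_on ballI admissible_order_continuous[OF adm]) simp
  then have "continuous_on (- {0}) (\<lambda>h::'a. \<phi> (norm h))"
    by (rule continuous_on_compose2) (auto intro: continuous_intros)
  then have "(\<lambda>h::'a. indicator (- {0}) h *\<^sub>R \<phi> (norm h)) \<in> borel_measurable borel"
    by (intro borel_measurable_continuous_on_indicator) auto
  then have "(\<lambda>h. a0 h / (norm h ^ DIM('a) * (indicator (- {0}) h *\<^sub>R \<phi> (norm h)))) \<in> borel_measurable borel"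
    using a0_meas by simp
  also have "(\<lambda>h. a0 h / (norm h ^ DIM('a) * (indicator (- {0}) h *\<^sub>R \<phi> (norm h)))) = jump_density a0 \<phi>"
    by (auto simp: jump_density_def indicator_def fun_eq_iff)
  finally show ?thesis .
qed

text \<open>Upper scaling from |h| to 1 bounds 1/\<phi>(|h|) by a multiple of |h| to the power
  -2\<delta>. Against |h| squared this leaves the positive power 2 - 2\<delta>, since \<delta> <
  1.\<close>

lemma integrable_jump_density_small:
  "integrable lborel (\<lambda>h. jump_density a0 \<phi> h * (norm h)\<^sup>2 * indicator (cball 0 1) h)"
proof -
  obtain \<delta> a where \<delta>: "\<delta> < 1" "1 \<le> a" "\<And>l r. 1 \<le> l \<Longrightarrow> 0 < r \<Longrightarrow> \<phi> (l * r) \<le> a * l powr (2 * \<delta>) * \<phi> r"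
    using adm unfolding admissible_order_def by blast
  have one: "\<phi> 1 = 1" using adm by (auto simp: admissible_order_def)
  let ?q = "\<lambda>j::nat. (1 / 2 :: real) ^ j"
  let ?B = "\<lambda>j. \<Lambda>2 * a * 2 ^ DIM('a) * ?q j powr (2 - 2 * \<delta>) / ?q j ^ DIM('a)"
  obtain b :: 'a where "b \<in> Basis" using nonempty_Basis by blast
  then have "b \<noteq> 0" by auto
  then have \<Lambda>2: "0 < \<Lambda>2" using a0_bounds[of b] \<Lambda>1 by auto
  show ?thesis
  proof (rule integrable_dyadic)
    show "(\<lambda>h. jump_density a0 \<phi> h * (norm h)\<^sup>2 * indicator (cball 0 1) h) \<in> borel_measurable borel"
      using jump_density_measurable by measurable (simp add: pred_def)
    show "0 \<le> ?B j" for j using \<Lambda>2 \<delta> by simp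
    show "0 \<le> ?q j" for j by simp
    show "\<exists>j. norm h \<le> ?q j \<and> jump_density a0 \<phi> h * (norm h)\<^sup>2 * indicator (cball 0 1) h \<le> ?B j"
      if "jump_density a0 \<phi> h * (norm h)\<^sup>2 * indicator (cball 0 1) h \<noteq> 0" for h :: 'a
    proof -
      have h: "0 < norm h" "norm h \<le> 1" using that by (auto simp: indicator_def split: if_splits)
      obtain j where j: "?q (Suc j) < norm h" "norm h \<le> ?q j" using dyadic_below_one[OF h] by blast
      have "1 \<le> a * (1 / norm h) powr (2 * \<delta>) * \<phi> (norm h)"
        using \<delta>(3)[of "1 / norm h" "norm h"] h one by simp
      then have 1: "1 / \<phi> (norm h) \<le> a * norm h powr (- 2 * \<delta>)"
        using order_pos[OF h(1)] h by (simp add: field_simps powr_minus powr_divide)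
      have "jump_density a0 \<phi> h * (norm h)\<^sup>2 = a0 h * (1 / \<phi> (norm h)) * (norm h)\<^sup>2 * (1 / norm h ^ DIM('a))"
        by (simp add: jump_density_def)
      \<comment> \<open>The lower end of the dyadic shell is \<open>?q (Suc j)\<close>, half of
        \<open>?q j\<close>; this is the origin of \<open>2 ^ DIM('a)\<close> in
        \<open>?B\<close>.\<close>
      also have "\<dots> \<le> \<Lambda>2 * (a * norm h powr (- 2 * \<delta>)) * (norm h)\<^sup>2 * (1 / ?q (Suc j) ^ DIM('a))"
        using a0_bounds[of h] h j 1 \<Lambda>2 \<Lambda>1 order_pos[OF h(1)] \<delta>(2)
        by (intro mult_mono divide_left_mono power_mono mult_nonneg_nonneg) auto
      also have "\<dots> = \<Lambda>2 * a * 2 ^ DIM('a) / ?q j ^ DIM('a) * norm h powr (2 - 2 * \<delta>)"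
        using h by (simp add: powr_diff powr_minus power_mult_distrib power_divide field_simps)
      also have "\<dots> \<le> \<Lambda>2 * a * 2 ^ DIM('a) / ?q j ^ DIM('a) * ?q j powr (2 - 2 * \<delta>)"
        using \<Lambda>2 \<delta> j h by (intro mult_left_mono powr_mono2) auto
      finally show ?thesis using h j by (intro exI[of _ j]) (simp add: mult_ac)
    qed
    have "?B j * ?q j ^ DIM('a) = \<Lambda>2 * a * 2 ^ DIM('a) * ((1 / 2) powr (2 - 2 * \<delta>)) ^ j" for j
      by (simp add: powr_power powr_realpow[symmetric] powr_powr mult_ac)
    moreover have "(1 / 2 :: real) powr (2 - 2 * \<delta>) < 1" using \<delta> by (simp add: powr01_less_one)
    ultimately show "summable (\<lambda>j. ?B j * ?q j ^ DIM('a))"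
      by (simp only:) (intro summable_mult summable_geometric, simp)
  qed (use jump_density_nonneg in auto)
qed

text \<open>Lower scaling from 1 to |h| makes the density decay like |h| to the power -d -
  2\<delta>, which is integrable at infinity since \<delta> > 0.\<close>

lemma integrable_jump_density_large:
  "integrable lborel (\<lambda>h. jump_density a0 \<phi> h * indicator (- cball 0 1) h)"
proof -
  obtain \<delta> a where \<delta>: "0 < \<delta>" "0 < a" "\<And>l r. 1 \<le> l \<Longrightarrow> 0 < r \<Longrightarrow> a * l powr (2 * \<delta>) * \<phi> r \<le> \<phi> (l * r)"
    using adm unfolding admissible_order_def by blast
  have one: "\<phi> 1 = 1" using adm by (auto simp: admissible_order_def)
  let ?q = "\<lambda>j::nat. 2 ^ j :: real"
  let ?B = "\<lambda>j. \<Lambda>2 / (?q j ^ DIM('a) * (a * ?q j powr (2 * \<delta>)))"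
  obtain b :: 'a where "b \<in> Basis" using nonempty_Basis by blast
  then have "b \<noteq> 0" by auto
  then have \<Lambda>2: "0 < \<Lambda>2" using a0_bounds[of b] \<Lambda>1 by auto
  show ?thesis
  proof (rule integrable_dyadic)
    show "(\<lambda>h. jump_density a0 \<phi> h * indicator (- cball 0 1) h) \<in> borel_measurable borel"
      using jump_density_measurable by measurable (simp add: pred_def)
    show "0 \<le> ?B j" for j using \<Lambda>2 \<delta> by simp
    show "0 \<le> 2 * ?q j" for j by simp
    show "\<exists>j. norm h \<le> 2 * ?q j \<and> jump_density a0 \<phi> h * indicator (- cball 0 1) h \<le> ?B j"
      if "jump_density a0 \<phi> h * indicator (- cball 0 1) h \<noteq> 0" for h :: 'a
    proof -
      have h: "1 < norm h" using that by (auto simp: indicator_def split: if_splits)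
      \<comment> \<open>The dyadic shell is found by inversion, from the position of 1/|h| in the
        unit interval.\<close>
      have "0 < 1 / norm h" "1 / norm h \<le> 1" using h by (auto simp: divide_le_eq_1)
      then obtain j where j: "(1 / 2) ^ Suc j < 1 / norm h" "1 / norm h \<le> (1 / 2) ^ j" using dyadic_below_one by blast
      moreover have "0 < norm h" using h by linarith
      ultimately have j: "?q j \<le> norm h" "norm h \<le> 2 * ?q j"
        by (auto simp: field_simps power_divide)
      have "a * ?q j powr (2 * \<delta>) \<le> a * norm h powr (2 * \<delta>)"
        using \<delta> j by (intro mult_left_mono powr_mono2) auto
      also have "\<dots> \<le> \<phi> (norm h)" using \<delta>(3)[of "norm h" 1] h one by simp
      finally have 1: "a * ?q j powr (2 * \<delta>) \<le> \<phi> (norm h)" .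
      have "?q j ^ DIM('a) \<le> norm h ^ DIM('a)" using j by (intro power_mono) auto
      then have "?q j ^ DIM('a) * (a * ?q j powr (2 * \<delta>)) \<le> norm h ^ DIM('a) * \<phi> (norm h)"
        by (rule mult_mono[OF _ 1]) (use \<delta>(2) in simp_all)
      moreover have "h \<noteq> 0" using h by auto
      moreover have "0 < ?q j ^ DIM('a) * (a * ?q j powr (2 * \<delta>))" using \<delta>(2) by simp
      ultimately have "jump_density a0 \<phi> h \<le> ?B j"
        unfolding jump_density_def using a0_bounds[of h] \<Lambda>2 by (intro frac_le) simp_all
      then show ?thesis using h j by (intro exI[of _ j]) simp
    qed
    have "?B j * (2 * ?q j) ^ DIM('a) = \<Lambda>2 / a * 2 ^ DIM('a) * ((1 / 2) powr (2 * \<delta>)) ^ j" for j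
      using \<delta> by (simp add: power_mult_distrib field_simps powr_divide power_divide powr_power powr_realpow[symmetric] powr_powr)
    moreover have "(1 / 2 :: real) powr (2 * \<delta>) < 1" using \<delta> by (simp add: powr01_less_one)
    ultimately show "summable (\<lambda>j. ?B j * (2 * ?q j) ^ DIM('a))"
      by (simp only:) (intro summable_mult summable_geometric, simp)
  qed (use jump_density_nonneg in auto)
qed

lemma levy_density_jump_density: "levy_density (jump_density a0 \<phi>)"
  unfolding levy_density_def
proof (intro conjI allI jump_density_measurable jump_density_nonneg)
  have "jump_density a0 \<phi> h * min 1 ((norm h)\<^sup>2) = jump_density a0 \<phi> h * (norm h)\<^sup>2 * indicator (cball 0 1) h
     + jump_density a0 \<phi> h * indicator (- cball 0 1) h" for h
    using abs_square_le_1[of "norm h"] by (auto simp: indicator_def)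
  then show "integrable lborel (\<lambda>h. jump_density a0 \<phi> h * min 1 ((norm h)\<^sup>2))"
    using Bochner_Integration.integrable_add[OF integrable_jump_density_small integrable_jump_density_large] by simp
qed

lemma levy_exponent_eq: "levy_exponent (levy_measure a0 \<phi>) \<xi> = density_exponent (jump_density a0 \<phi>) \<xi>"
  unfolding levy_exponent_def levy_measure_def density_exponent_def jump_density_def[symmetric] levy_integrand_def[symmetric]
  by (rule integral_density) (use jump_density_measurable jump_density_nonneg in auto)

text \<open>With \<phi>(r) = t, lower scaling from |h| to \<open>r\<close> gives \<phi>(|h|) at most
  \<open>t / (a * q ^ n)\<close> on the n-th cube. The factor \<open>t\<close> in the exponent then
  cancels, so the weights \<open>c * q ^ n\<close> do not depend on \<open>t\<close>; only the side
  lengths carry \<open>r\<close>, whence a constant uniform in \<open>t\<close>.\<close>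

lemma mult_bound_derivative_levy:
  assumes \<kappa>: "0 < \<kappa>"
  shows "\<exists>C>0. \<forall>t>0. \<forall>b\<in>Basis. mult_bound (\<lambda>\<xi>. \<i> * of_real (\<xi> \<bullet> b) *
     exp (- (of_real (\<kappa> * t) * levy_exponent (levy_measure a0 \<phi>) \<xi>))) (C / order_inv \<phi> t)"
proof -
  obtain \<delta> a where \<delta>: "0 < \<delta>" "0 < a" "\<And>l r. 1 \<le> l \<Longrightarrow> 0 < r \<Longrightarrow> a * l powr (2 * \<delta>) * \<phi> r \<le> \<phi> (l * r)"
    using adm unfolding admissible_order_def by blast
  define q where "q = (2::real) powr (2 * \<delta>)"
  have q: "1 < q" using \<delta> by (simp add: q_def)
  define d where "d = real DIM('a)"
  have d: "0 < d" by (simp add: d_def)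
  define c where "c = \<kappa> * \<Lambda>1 * a / (2 * d) ^ DIM('a)"
  have c: "0 < c" using \<kappa> \<Lambda>1 \<delta> d by (simp add: c_def)
  let ?w = "\<lambda>n. c * q ^ n"
  let ?e = "\<lambda>n. exp (- (\<Sum>m<n. ?w m)) * 2 ^ n"
  note summ = summable_doubling_exp_geometric[OF c q]
  have "0 < suminf ?e" by (rule suminf_pos[OF summ]) simp
  show ?thesis
  proof (intro exI[of _ "4 * d * suminf ?e"] conjI allI impI ballI)
    show "0 < 4 * d * suminf ?e" using \<open>0 < suminf ?e\<close> d by simp
    fix t :: real and b :: 'a assume t: "0 < t" and b: "b \<in> Basis"
    define r where "r = order_inv \<phi> t"
    have r: "0 < r" "\<phi> r = t" using order_inv[OF adm t] by (auto simp: r_def)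
    \<comment> \<open>The factor \<open>2 * d\<close> keeps the l1 norm of points of the cube below
      \<open>r * (1 / 2) ^ n\<close>; it also produces the \<open>4 * d\<close> in the
      constant.\<close>
    define \<rho> where "\<rho> n = r * (1 / 2) ^ n / (2 * d)" for n :: nat
    have \<rho>: "0 < \<rho> n" for n using r d by (simp add: \<rho>_def)
    have e: "exp (- (\<Sum>m<n. ?w m)) * (2 / \<rho> n) = 4 * d / r * ?e n" for n
      using r d by (simp add: \<rho>_def power_divide field_simps)
    have "mult_bound (\<lambda>\<xi>. \<i> * of_real (\<xi> \<bullet> b) * exp (- density_exponent (\<lambda>h. (\<kappa> * t) * jump_density a0 \<phi> h) \<xi>))
       (\<Sum>n. exp (- (\<Sum>m<n. ?w m)) * (2 / \<rho> n))"
    proof (rule mult_bound_derivative_exp_density_exponent)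
      show "2 * \<rho> (Suc n) \<le> \<rho> n" for n using r d by (simp add: \<rho>_def)
      show "0 \<le> ?w n" for n using c q by simp
      show "levy_density (\<lambda>h. \<kappa> * t * jump_density a0 \<phi> h)"
        using levy_density_jump_density t \<kappa> by (intro levy_density_cmult) auto
      show "summable (\<lambda>n. exp (- (\<Sum>m<n. ?w m)) * (2 / \<rho> n))"
        unfolding e by (intro summable_mult summ)
      show "?w n / \<rho> n ^ DIM('a) \<le> \<kappa> * t * jump_density a0 \<phi> h" if h: "h \<in> cube (\<rho> n)" for n h
      proof -
        have hb: "\<rho> n < h \<bullet> i" "h \<bullet> i < 2 * \<rho> n" if "i \<in> Basis" for i
          using h that by (auto simp: cube_def box_def)
        have "norm h \<le> (\<Sum>i\<in>Basis. \<bar>h \<bullet> i\<bar>)" by (rule norm_le_l1)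
        also have "\<dots> \<le> of_nat (card (Basis :: 'a set)) * (2 * \<rho> n)"
          by (rule sum_bounded_above) (use hb \<rho>[of n] in force)
        also have "\<dots> = r * (1 / 2) ^ n" using d by (simp add: \<rho>_def d_def)
        finally have h1: "norm h \<le> r * (1 / 2) ^ n" .
        have h0: "0 < norm h" using hb[OF b] \<rho>[of n] by auto
        have l: "2 ^ n \<le> r / norm h" using h1 h0 by (simp add: field_simps power_divide)
        have "a * q ^ n * \<phi> (norm h) = a * (2 ^ n) powr (2 * \<delta>) * \<phi> (norm h)"
          by (simp add: q_def powr_power powr_realpow[symmetric] powr_powr mult_ac)
        also have "\<dots> \<le> a * (r / norm h) powr (2 * \<delta>) * \<phi> (norm h)"
          using l \<delta> order_pos[OF h0] by (intro mult_left_mono mult_right_mono powr_mono2) auto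
        also have "\<dots> \<le> t"
          using \<delta>(3)[of "r / norm h" "norm h"] h0 r order_trans[OF one_le_power l, of] by simp
        finally have ph: "\<phi> (norm h) \<le> t / (a * q ^ n)"
          using \<delta> q by (simp add: field_simps)
        have "norm h ^ DIM('a) \<le> (r * (1 / 2) ^ n) ^ DIM('a)" using h1 by (intro power_mono) auto
        then have "norm h ^ DIM('a) * \<phi> (norm h) \<le> (r * (1 / 2) ^ n) ^ DIM('a) * (t / (a * q ^ n))"
          by (rule mult_mono[OF _ ph]) (use r(1) less_imp_le[OF order_pos[OF h0]] in simp_all)
        moreover have "h \<noteq> 0" "0 < norm h ^ DIM('a) * \<phi> (norm h)" using h0 order_pos[OF h0] by auto
        ultimately have "\<Lambda>1 / ((r * (1 / 2) ^ n) ^ DIM('a) * (t / (a * q ^ n))) \<le> jump_density a0 \<phi> h"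
          unfolding jump_density_def using a0_bounds[of h] \<Lambda>1 by (intro frac_le) simp_all
        then have "\<kappa> * t * (\<Lambda>1 / ((r * (1 / 2) ^ n) ^ DIM('a) * (t / (a * q ^ n)))) \<le> \<kappa> * t * jump_density a0 \<phi> h"
          using \<kappa> t by (intro mult_left_mono) auto
        also have "\<kappa> * t * (\<Lambda>1 / ((r * (1 / 2) ^ n) ^ DIM('a) * (t / (a * q ^ n)))) = ?w n / \<rho> n ^ DIM('a)"
        proof -
          define X where "X = (r * (1 / 2) ^ n) ^ DIM('a)"
          define Y where "Y = (2 * d) ^ DIM('a)"
          have "\<rho> n ^ DIM('a) = X / Y" unfolding \<rho>_def X_def Y_def by (rule power_divide)
          moreover have "c = \<kappa> * \<Lambda>1 * a / Y" unfolding c_def Y_def ..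
          moreover have "Y \<noteq> 0" using d by (simp add: Y_def)
          ultimately show ?thesis using t unfolding X_def[symmetric] by simp
        qed
        finally show ?thesis .
      qed
    qed (use \<rho> b in auto)
    also have "(\<Sum>n. exp (- (\<Sum>m<n. ?w m)) * (2 / \<rho> n)) = 4 * d * suminf ?e / order_inv \<phi> t"
      unfolding e using suminf_mult[OF summ, of "4 * d / r"] by (simp add: r_def)
    finally show "mult_bound (\<lambda>\<xi>. \<i> * of_real (\<xi> \<bullet> b) *
       exp (- (of_real (\<kappa> * t) * levy_exponent (levy_measure a0 \<phi>) \<xi>))) (4 * d * suminf ?e / order_inv \<phi> t)"
      by (simp add: levy_exponent_eq density_exponent_cmult)
  qed
qed

end

section \<open>Limits of derivatives\<close>

text \<open>\<open>pderivs\<close> sees basis directions only; this crude bound recovers the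
  operator norm needed by the mean value inequality.\<close>

lemma linear_bound_Basis:
  fixes f :: "'a::euclidean_space \<Rightarrow> real"
  assumes "linear f" "\<And>i. i \<in> Basis \<Longrightarrow> \<bar>f i\<bar> \<le> B"
  shows "\<bar>f v\<bar> \<le> real DIM('a) * B * norm v"
proof -
  have "f v = (\<Sum>i\<in>Basis. (v \<bullet> i) * f i)"
    by (subst euclidean_representation[of v, symmetric])
      (simp only: linear_sum[OF assms(1)] linear_cmul[OF assms(1)] real_scaleR_def)
  also have "\<bar>\<dots>\<bar> \<le> (\<Sum>i\<in>Basis. \<bar>(v \<bullet> i) * f i\<bar>)" by (rule sum_abs)
  also have "\<dots> \<le> real DIM('a) * (norm v * B)"
    by (rule sum_bounded_above) (auto simp: abs_mult intro!: mult_mono Basis_le_norm assms(2))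
  finally show ?thesis by (simp add: mult_ac)
qed

lemma differentiable_frechet:
  "f differentiable (at x) \<Longrightarrow> (f has_derivative frechet_derivative f (at x)) (at x)"
  by (simp add: frechet_derivative_works)

lemma linear_frechet_derivative': "f differentiable (at x) \<Longrightarrow> linear (frechet_derivative f (at x))"
  using frechet_derivative_works has_derivative_linear by blast

lemma lipschitz_partial_derivatives:
  fixes f :: "'a::euclidean_space \<Rightarrow> real"
  assumes d: "\<And>x. f differentiable (at x)" and B: "\<And>x i. i \<in> Basis \<Longrightarrow> \<bar>frechet_derivative f (at x) i\<bar> \<le> B"
  shows "\<bar>f x - f y\<bar> \<le> real DIM('a) * B * norm (x - y)"
proof -
  have "norm (f x - f y) \<le> real DIM('a) * B * norm (x - y)"
    by (rule differentiable_bound[OF convex_UNIV])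
      (use differentiable_frechet[OF d] linear_bound_Basis[OF linear_frechet_derivative'[OF d] B]
        in \<open>auto intro!: onorm_le\<close>)
  then show ?thesis by simp
qed

lemma taylor1_lipschitz_partial_derivatives:
  fixes f :: "'a::euclidean_space \<Rightarrow> real"
  assumes d: "\<And>x. f differentiable (at x)"
    and L: "\<And>x y i. i \<in> Basis \<Longrightarrow> \<bar>frechet_derivative f (at x) i - frechet_derivative f (at y) i\<bar> \<le> L * norm (x - y)"
  shows "\<bar>f y - f x - frechet_derivative f (at x) (y - x)\<bar> \<le> real DIM('a) * L * (norm (y - x))\<^sup>2"
proof -
  let ?D = "\<lambda>z. frechet_derivative f (at z)"
  obtain b :: 'a where b: "b \<in> Basis" using nonempty_Basis by blast
  \<comment> \<open>Nonnegativity is read off from the Lipschitz bound at two points at distance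
    1.\<close>
  have L0: "0 \<le> L" using L[OF b, of b 0] norm_Basis[OF b] by simp
  have "norm (f y - f x - ?D x (y - x)) \<le> norm (y - x) * (real DIM('a) * (L * norm (y - x)))"
  proof (rule differentiable_bound_linearization[where S = "closed_segment x y"])
    show "x + t *\<^sub>R (y - x) \<in> closed_segment x y" if "t \<in> {0..1}" for t
      using that by (auto simp: in_segment algebra_simps intro!: exI[of _ t])
    show "(f has_derivative ?D z) (at z within closed_segment x y)" for z
      using differentiable_frechet[OF d] has_derivative_at_withinI by blast
    show "onorm (?D z - ?D x) \<le> real DIM('a) * (L * norm (y - x))" if "z \<in> closed_segment x y" for z
    proof (rule onorm_le)
      fix v
      have "norm (z - x) \<le> norm (y - x)" using segment_bound[OF that] by (simp add: norm_minus_commute)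
      then have "\<bar>?D z i - ?D x i\<bar> \<le> L * norm (y - x)" if "i \<in> Basis" for i
        using L[OF that, of z x] L0 by (meson mult_left_mono order_trans)
      then show "norm ((?D z - ?D x) v) \<le> real DIM('a) * (L * norm (y - x)) * norm v"
        using linear_bound_Basis[OF linear_compose_sub[OF linear_frechet_derivative'[OF d, of z] linear_frechet_derivative'[OF d, of x]], of "L * norm (y - x)" v]
        by simp
    qed
  qed simp
  then show ?thesis by (simp add: power2_eq_square mult_ac)
qed

text \<open>A uniform quadratic Taylor remainder makes the partial derivatives a Cauchy sequence, so
  pointwise convergence of the functions suffices.\<close>

lemma tendsto_frechet_derivative:
  fixes g :: "nat \<Rightarrow> 'a::euclidean_space \<Rightarrow> real"
  assumes d: "\<And>n x. g n differentiable (at x)"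
    and L: "\<And>n x y i. i \<in> Basis \<Longrightarrow> \<bar>frechet_derivative (g n) (at x) i - frechet_derivative (g n) (at y) i\<bar> \<le> L * norm (x - y)"
    and lim: "\<And>x. (\<lambda>n. g n x) \<longlonglongrightarrow> w x"
  shows "w differentiable (at x)"
    and "i \<in> Basis \<Longrightarrow> (\<lambda>n. frechet_derivative (g n) (at x) i) \<longlonglongrightarrow> frechet_derivative w (at x) i"
proof -
  let ?D = "\<lambda>n. frechet_derivative (g n) (at x)"
  define M where "M = real DIM('a) * L"
  obtain b :: 'a where b: "b \<in> Basis" using nonempty_Basis by blast
  have "0 \<le> L" using L[OF b, of 0 b 0] norm_Basis[OF b] by simp
  then have M0: "0 \<le> M" by (simp add: M_def)
  have taylor: "\<bar>g n y - g n x - ?D n (y - x)\<bar> \<le> M * (norm (y - x))\<^sup>2" for n y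
    unfolding M_def by (rule taylor1_lipschitz_partial_derivatives[OF d L])
  have lin: "linear (?D n)" for n by (rule linear_frechet_derivative'[OF d])
  have "convergent (\<lambda>n. ?D n i)" if i: "i \<in> Basis" for i
  proof (rule Cauchy_convergent, rule CauchyI)
    fix e :: real assume e: "0 < e"
    \<comment> \<open>A step this small makes the quadratic remainder over \<open>h\<close> at most
      \<open>e / 4\<close>, uniformly in \<open>n\<close>. With \<open>h\<close> fixed, the
      difference quotients \<open>q n\<close> converge since the functions do, and e/4 + e/2 + e/4
      closes the Cauchy estimate.\<close>
    define h where "h = e / (4 * (M + 1))"
    have h: "0 < h" using e M0 by (simp add: h_def)
    have Mh: "M * h \<le> e / 4" using e M0 by (simp add: h_def field_simps)
    define q where "q n = (g n (x + h *\<^sub>R i) - g n x) / h" for n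
    have q: "\<bar>q n - ?D n i\<bar> \<le> e / 4" for n
    proof -
      have "h * (q n - ?D n i) = g n (x + h *\<^sub>R i) - g n x - ?D n (h *\<^sub>R i)"
      proof -
        have "h * q n = g n (x + h *\<^sub>R i) - g n x" using h by (simp add: q_def)
        then show ?thesis using linear_cmul[OF lin, of n h i] by (simp add: right_diff_distrib)
      qed
      then have "\<bar>h * (q n - ?D n i)\<bar> \<le> M * h\<^sup>2"
        using taylor[of n "x + h *\<^sub>R i"] i h by simp
      then have "h * \<bar>q n - ?D n i\<bar> \<le> h * (M * h)" using h by (simp add: abs_mult power2_eq_square mult_ac)
      then have "\<bar>q n - ?D n i\<bar> \<le> M * h" using h by (rule mult_left_le_imp_le)
      then show ?thesis using Mh by (rule order_trans)
    qed
    have "Cauchy q"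
      unfolding q_def by (intro LIMSEQ_imp_Cauchy[of _ "(w (x + h *\<^sub>R i) - w x) / h"] tendsto_intros lim) (use h in simp)
    then obtain N where N: "\<And>m n. m \<ge> N \<Longrightarrow> n \<ge> N \<Longrightarrow> norm (q m - q n) < e / 2"
      using CauchyD[of q "e / 2"] e by auto
    have "norm (?D m i - ?D n i) < e" if "m \<ge> N" "n \<ge> N" for m n
      using q[of m] q[of n] N[OF that] unfolding real_norm_def abs_le_iff abs_less_iff by linarith
    then show "\<exists>N. \<forall>m\<ge>N. \<forall>n\<ge>N. norm (?D m i - ?D n i) < e" by blast
  qed
  then obtain E where E: "\<And>i. i \<in> Basis \<Longrightarrow> (\<lambda>n. ?D n i) \<longlonglongrightarrow> E i"
    unfolding convergent_def by metis
  have rep: "?D n v = (\<Sum>i\<in>Basis. (v \<bullet> i) * ?D n i)" for n v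
    by (subst euclidean_representation[of v, symmetric])
      (simp only: linear_sum[OF lin] linear_cmul[OF lin] real_scaleR_def)
  define W where "W v = (\<Sum>i\<in>Basis. (v \<bullet> i) * E i)" for v
  have W: "(\<lambda>n. ?D n v) \<longlonglongrightarrow> W v" for v
    unfolding W_def rep[of _ v] by (intro tendsto_intros E)
  have quad: "\<bar>w y - w x - W (y - x)\<bar> \<le> M * (norm (y - x))\<^sup>2" for y
    by (rule LIMSEQ_le_const2[of "\<lambda>n. \<bar>g n y - g n x - ?D n (y - x)\<bar>"])
      (use taylor in \<open>auto intro!: tendsto_intros lim W\<close>)
  have WD: "(w has_derivative W) (at x)"
  proof (rule has_derivativeI_sandwich[of 1])
    show "bounded_linear W"
      unfolding W_def by (intro bounded_linear_sum bounded_linear_mult_const bounded_linear_inner_left)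
    show "((\<lambda>y. M * norm (y - x)) \<longlongrightarrow> 0) (at x)"
      by (rule tendsto_eq_intros refl | simp)+
    show "norm (w y - w x - W (y - x)) / norm (y - x) \<le> M * norm (y - x)" if "y \<noteq> x" for y
      using quad[of y] that by (simp add: divide_le_eq power2_eq_square mult.assoc)
  qed simp
  show "w differentiable (at x)" using WD by (auto simp: differentiable_def)
  have "frechet_derivative w (at x) = W" using frechet_derivative_at[OF WD] by simp
  then show "i \<in> Basis \<Longrightarrow> (\<lambda>n. ?D n i) \<longlonglongrightarrow> frechet_derivative w (at x) i" using W by simp
qed

text \<open>Bounds on all orders, uniform in \<open>n\<close>, turn pointwise convergence into
  convergence of all derivatives: induction on the multi-index, each step gaining one
  derivative.\<close>

lemma tendsto_pderivs:
  fixes u :: "nat \<Rightarrow> 'a::euclidean_space \<Rightarrow> real"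
  assumes sm: "\<And>n. smooth_Rd (u n)"
    and B: "\<And>n \<gamma> x. set \<gamma> \<subseteq> Basis \<Longrightarrow> \<bar>pderivs \<gamma> (u n) x\<bar> \<le> B (length \<gamma>)"
    and lim: "\<And>x. (\<lambda>n. u n x) \<longlonglongrightarrow> v x"
  shows "set \<gamma> \<subseteq> Basis \<Longrightarrow> (\<lambda>n. pderivs \<gamma> (u n) x) \<longlonglongrightarrow> pderivs \<gamma> v x"
    and "set \<gamma> \<subseteq> Basis \<Longrightarrow> pderivs \<gamma> v differentiable (at x)"
proof -
  have D: "pderivs \<gamma> (u n) differentiable (at x)" if "set \<gamma> \<subseteq> Basis" for \<gamma> n x
    using sm that by (auto simp: smooth_Rd_def)
  have L: "\<bar>frechet_derivative (pderivs \<gamma> (u n)) (at x) i - frechet_derivative (pderivs \<gamma> (u n)) (at y) i\<bar>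
     \<le> (real DIM('a) * B (length \<gamma> + 2)) * norm (x - y)" if "set \<gamma> \<subseteq> Basis" "i \<in> Basis" for \<gamma> n x y i
  proof -
    have "\<bar>pderivs (i # \<gamma>) (u n) x - pderivs (i # \<gamma>) (u n) y\<bar> \<le> (real DIM('a) * B (length \<gamma> + 2)) * norm (x - y)"
    proof (rule lipschitz_partial_derivatives)
      show "pderivs (i # \<gamma>) (u n) differentiable (at x)" for x by (rule D) (use that in simp)
      \<comment> \<open>Two orders above \<gamma>: one for the derivative whose limit is sought, one
        more for its Lipschitz constant.\<close>
      show "\<bar>frechet_derivative (pderivs (i # \<gamma>) (u n)) (at x) j\<bar> \<le> B (length \<gamma> + 2)" if "j \<in> Basis" for x j
        using B[of "j # i # \<gamma>" n x] that \<open>set \<gamma> \<subseteq> Basis\<close> \<open>i \<in> Basis\<close> by simp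
    qed
    then show ?thesis by simp
  qed
  have conv: "\<forall>x. (\<lambda>n. pderivs \<gamma> (u n) x) \<longlonglongrightarrow> pderivs \<gamma> v x" if "set \<gamma> \<subseteq> Basis" for \<gamma>
    using that
  proof (induction \<gamma>)
    case Nil
    then show ?case using lim by simp
  next
    case (Cons i \<gamma>)
    then have \<gamma>: "set \<gamma> \<subseteq> Basis" "i \<in> Basis" and *: "\<And>x. (\<lambda>n. pderivs \<gamma> (u n) x) \<longlonglongrightarrow> pderivs \<gamma> v x" by auto
    show ?case using tendsto_frechet_derivative(2)[OF D[OF \<gamma>(1)] L[OF \<gamma>(1)] * \<gamma>(2)] by simp
  qed
  then show "set \<gamma> \<subseteq> Basis \<Longrightarrow> (\<lambda>n. pderivs \<gamma> (u n) x) \<longlonglongrightarrow> pderivs \<gamma> v x" by blast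
  assume \<gamma>: "set \<gamma> \<subseteq> Basis"
  with conv have *: "\<And>x. (\<lambda>n. pderivs \<gamma> (u n) x) \<longlonglongrightarrow> pderivs \<gamma> v x" by blast
  show "pderivs \<gamma> v differentiable (at x)"
    by (rule tendsto_frechet_derivative(1)[OF D[OF \<gamma>] L[OF \<gamma>] *])
qed

section \<open>Approximation by trigonometric polynomials\<close>

definition trig_poly :: "('a::euclidean_space \<Rightarrow> complex) \<Rightarrow> bool" where
  "trig_poly F \<longleftrightarrow> (\<exists>A c. finite A \<and> F = trig A c)"

lemma trig_poly_cis: "trig_poly (\<lambda>x. z * cis (\<eta> \<bullet> x))"
  unfolding trig_poly_def by (intro exI[of _ "{\<eta>}"] exI[of _ "\<lambda>_. z"]) (simp add: trig_def fun_eq_iff)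

text \<open>The coefficients are padded by 0 to the union of the frequency sets, since
  \<open>trig\<close> needs one common index set.\<close>

lemma trig_poly_add:
  assumes "trig_poly F" "trig_poly G"
  shows "trig_poly (\<lambda>x. F x + G x)"
proof -
  obtain A c B d where *: "finite A" "F = trig A c" "finite B" "G = trig B d"
    using assms by (auto simp: trig_poly_def)
  let ?e = "\<lambda>\<xi>. (if \<xi> \<in> A then c \<xi> else 0) + (if \<xi> \<in> B then d \<xi> else 0)"
  have "F x + G x = trig (A \<union> B) ?e x" for x
  proof -
    have "(\<Sum>\<xi>\<in>A \<union> B. (if \<xi> \<in> A then c \<xi> else 0) * cis (\<xi> \<bullet> x)) = (\<Sum>\<xi>\<in>A. c \<xi> * cis (\<xi> \<bullet> x))"
      by (rule sum.mono_neutral_cong_right) (use * in auto)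
    moreover have "(\<Sum>\<xi>\<in>A \<union> B. (if \<xi> \<in> B then d \<xi> else 0) * cis (\<xi> \<bullet> x)) = (\<Sum>\<xi>\<in>B. d \<xi> * cis (\<xi> \<bullet> x))"
      by (rule sum.mono_neutral_cong_right) (use * in auto)
    ultimately show ?thesis unfolding *(2,4) trig_def distrib_right sum.distrib by simp
  qed
  then show ?thesis unfolding trig_poly_def using *(1,3)
    by (intro exI[of _ "A \<union> B"] exI[of _ ?e]) (simp add: fun_eq_iff)
qed

lemma trig_poly_const: "trig_poly (\<lambda>_. z)"
  using trig_poly_cis[of z 0] by simp

lemma trig_poly_sum:
  "finite I \<Longrightarrow> (\<And>i. i \<in> I \<Longrightarrow> trig_poly (F i)) \<Longrightarrow> trig_poly (\<lambda>x. \<Sum>i\<in>I. F i x)"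
proof (induction I rule: finite_induct)
  case empty
  then show ?case using trig_poly_const[of 0] by simp
next
  case (insert i I)
  then show ?case using trig_poly_add[of "F i" "\<lambda>x. \<Sum>i\<in>I. F i x"] by simp
qed

text \<open>Different pairs of frequencies may have the same sum. Closure under addition collects
  such collisions, so no explicit convolution of coefficients is needed.\<close>

lemma trig_poly_mult:
  assumes "trig_poly F" "trig_poly G"
  shows "trig_poly (\<lambda>x. F x * G x)"
proof -
  obtain A c B d where *: "finite A" "F = trig A c" "finite B" "G = trig B d"
    using assms by (auto simp: trig_poly_def)
  have "trig_poly (\<lambda>x. \<Sum>\<xi>\<in>A. \<Sum>\<eta>\<in>B. (c \<xi> * d \<eta>) * cis ((\<xi> + \<eta>) \<bullet> x))"
    by (intro trig_poly_sum * trig_poly_cis)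
  also have "(\<lambda>x. \<Sum>\<xi>\<in>A. \<Sum>\<eta>\<in>B. (c \<xi> * d \<eta>) * cis ((\<xi> + \<eta>) \<bullet> x)) = (\<lambda>x. F x * G x)"
    unfolding *(2,4) trig_def sum_product
    by (intro ext sum.cong refl) (simp add: inner_add_left cis_mult[symmetric])
  finally show ?thesis .
qed

lemma trig_poly_sin: "trig_poly (\<lambda>x. complex_of_real (sin (\<eta> \<bullet> x)))"
proof -
  have "complex_of_real (sin y) = (- \<i> / 2) * cis y + (\<i> / 2) * cis (- y)" for y
    by (simp add: complex_eq_iff)
  then have "(\<lambda>x. complex_of_real (sin (\<eta> \<bullet> x))) = (\<lambda>x. (- \<i> / 2) * cis (\<eta> \<bullet> x) + (\<i> / 2) * cis ((- \<eta>) \<bullet> x))"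
    by simp
  then show ?thesis by (simp only:) (intro trig_poly_add trig_poly_cis)
qed

lemma trig_poly_polynomial_sin:
  fixes g :: "'a::euclidean_space \<Rightarrow> real"
  assumes "real_polynomial_function g"
  shows "trig_poly (\<lambda>x. complex_of_real (g (\<Sum>b\<in>Basis. sin ((b /\<^sub>R R) \<bullet> x) *\<^sub>R b)))"
  using assms
proof (induction rule: real_polynomial_function.induct)
  case (linear f)
  then have l: "linear f" by (rule bounded_linear.linear)
  have "f (\<Sum>b\<in>Basis. sin ((b /\<^sub>R R) \<bullet> x) *\<^sub>R b) = (\<Sum>b\<in>Basis. sin ((b /\<^sub>R R) \<bullet> x) * f b)" for x
    by (simp only: linear_sum[OF l] linear_cmul[OF l] real_scaleR_def)
  then have "(\<lambda>x. complex_of_real (f (\<Sum>b\<in>Basis. sin ((b /\<^sub>R R) \<bullet> x) *\<^sub>R b)))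
     = (\<lambda>x. \<Sum>b\<in>Basis. complex_of_real (sin ((b /\<^sub>R R) \<bullet> x)) * complex_of_real (f b))"
    by (simp only: of_real_sum of_real_mult)
  then show ?case
    by (simp only:) (intro trig_poly_sum finite_Basis trig_poly_mult trig_poly_sin trig_poly_const)
qed (simp_all only: of_real_add of_real_mult trig_poly_const trig_poly_add trig_poly_mult)

text \<open>Approximates \<open>s \<mapsto> f (R arcsin s)\<close> by a polynomial on the cube and substitutes \<open>s = sin (x / R)\<close>,
  which keeps the global bound and recovers \<open>f\<close> near the origin.\<close>

lemma trig_poly_approximation_ball:
  fixes f :: "'a::euclidean_space \<Rightarrow> real"
  assumes f: "continuous_on UNIV f" and S: "\<And>x. \<bar>f x\<bar> \<le> S" and e: "0 < e" and R: "0 < R"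
  shows "\<exists>F. trig_poly (\<lambda>x. complex_of_real (F x)) \<and> (\<forall>x. \<bar>F x\<bar> \<le> S + e) \<and> (\<forall>x. norm x \<le> R \<longrightarrow> \<bar>F x - f x\<bar> \<le> e)"
proof -
  define G where "G s = f (\<Sum>b\<in>Basis. (R * arcsin (s \<bullet> b)) *\<^sub>R b)" for s :: 'a
  define \<sigma> where "\<sigma> x = (\<Sum>b\<in>Basis. sin ((b /\<^sub>R R) \<bullet> x) *\<^sub>R b)" for x :: 'a
  let ?K = "cbox (- One) One :: 'a set"
  have K: "- 1 \<le> s \<bullet> b \<and> s \<bullet> b \<le> 1" if "s \<in> ?K" "b \<in> Basis" for s b
    using that by (auto simp: mem_box)
  have "continuous_on ?K (\<lambda>s. \<Sum>b\<in>Basis. (R * arcsin (s \<bullet> b)) *\<^sub>R b)"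
    by (intro continuous_intros) (use K in auto)
  \<comment> \<open>\<open>G\<close> takes only values of \<open>f\<close>, hence inherits its
    global bound.\<close>
  then have "continuous_on ?K G"
    unfolding G_def by (rule continuous_on_compose2[OF f]) auto
  then obtain g where g: "real_polynomial_function g" "\<And>s. s \<in> ?K \<Longrightarrow> \<bar>G s - g s\<bar> < e"
    using Stone_Weierstrass_real_polynomial_function[of ?K G e] e by auto
  have \<sigma>b: "\<sigma> x \<bullet> b = sin ((b \<bullet> x) / R)" if "b \<in> Basis" for x b
    using that by (simp add: \<sigma>_def divide_inverse_commute)
  have \<sigma>K: "\<sigma> x \<in> ?K" for x by (simp add: mem_box \<sigma>b)
  show ?thesis
  proof (intro exI[of _ "\<lambda>x. g (\<sigma> x)"] conjI allI impI)
    show "trig_poly (\<lambda>x. complex_of_real (g (\<sigma> x)))"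
      unfolding \<sigma>_def by (rule trig_poly_polynomial_sin[OF g(1)])
    fix x
    have "\<bar>G (\<sigma> x)\<bar> \<le> S" unfolding G_def by (rule S)
    then show "\<bar>g (\<sigma> x)\<bar> \<le> S + e" using g(2)[OF \<sigma>K, of x] by linarith
    assume x: "norm x \<le> R"
    have "R * arcsin (\<sigma> x \<bullet> b) = x \<bullet> b" if b: "b \<in> Basis" for b
    proof -
      have "\<bar>b \<bullet> x\<bar> \<le> R" using Basis_le_norm[OF b, of x] x by (simp add: inner_commute)
      then have "\<bar>(b \<bullet> x) / R\<bar> \<le> 1" using R by (simp add: abs_divide)
      \<comment> \<open>Here 1 \<le> pi/2 places the argument in the range where
        \<open>arcsin\<close> inverts \<open>sin\<close>.\<close>
      then have "arcsin (sin ((b \<bullet> x) / R)) = (b \<bullet> x) / R"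
        using pi_ge_two by (intro arcsin_sin) linarith+
      then show ?thesis using R unfolding \<sigma>b[OF b] by (simp add: inner_commute)
    qed
    then have "(\<Sum>b\<in>Basis. (R * arcsin (\<sigma> x \<bullet> b)) *\<^sub>R b) = (\<Sum>b\<in>Basis. (x \<bullet> b) *\<^sub>R b)"
      by (intro sum.cong) simp_all
    then have "G (\<sigma> x) = f x" unfolding G_def by (simp only: euclidean_representation)
    then show "\<bar>g (\<sigma> x) - f x\<bar> \<le> e" using g(2)[OF \<sigma>K, of x] by linarith
  qed
qed

text \<open>Uniform limits of trigonometric polynomials are almost periodic, so for general
  \<open>f\<close> the convergence is only pointwise. The bounds tending to \<open>S\<close> keep
  the final constant sharp in the norm of \<open>f\<close>.\<close>

lemma trig_poly_approximation:
  fixes f :: "'a::euclidean_space \<Rightarrow> real"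
  assumes f: "continuous_on UNIV f" and S: "\<And>x. \<bar>f x\<bar> \<le> S"
  obtains F where "\<And>n. trig_poly (\<lambda>x. complex_of_real (F n x))"
    and "\<And>n x. \<bar>F n x\<bar> \<le> S + inverse (real (Suc n))" and "\<And>x. (\<lambda>n. F n x) \<longlonglongrightarrow> f x"
proof -
  have "\<exists>F. \<forall>n. trig_poly (\<lambda>x. complex_of_real (F n x)) \<and> (\<forall>x. \<bar>F n x\<bar> \<le> S + inverse (real (Suc n)))
     \<and> (\<forall>x. norm x \<le> real (Suc n) \<longrightarrow> \<bar>F n x - f x\<bar> \<le> inverse (real (Suc n)))"
    by (intro choice allI trig_poly_approximation_ball f S) simp_all
  then obtain F where F: "\<And>n. trig_poly (\<lambda>x. complex_of_real (F n x))" "\<And>n x. \<bar>F n x\<bar> \<le> S + inverse (real (Suc n))"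
    "\<And>n x. norm x \<le> real (Suc n) \<Longrightarrow> \<bar>F n x - f x\<bar> \<le> inverse (real (Suc n))"
    by metis
  have "(\<lambda>n. F n x) \<longlonglongrightarrow> f x" for x
  proof (rule LIM_zero_cancel, rule Lim_null_comparison[OF _ LIMSEQ_inverse_real_of_nat])
    obtain N where "norm x \<le> real N" using real_arch_simple by blast
    then show "\<forall>\<^sub>F n in sequentially. norm (F n x - f x) \<le> inverse (real (Suc n))"
      unfolding eventually_sequentially by (intro exI[of _ N] allI impI) (simp only: real_norm_def, rule F(3), linarith)
  qed
  with F(1,2) show ?thesis by (rule that)
qed

section \<open>Derivatives of trigonometric polynomials\<close>

lemma has_derivative_Re_trig:
  "((\<lambda>x. Re (trig A c x)) has_derivative (\<lambda>v. Re (trig A (\<lambda>\<xi>. \<i> * of_real (\<xi> \<bullet> v) * c \<xi>) x))) (at x)"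
proof -
  have "((\<lambda>x. cis (\<xi> \<bullet> x)) has_derivative (\<lambda>v. cis (\<xi> \<bullet> x) * (\<i> * of_real (\<xi> \<bullet> v)))) (at x)" for \<xi>
    by (auto intro!: derivative_eq_intros simp: scaleR_conv_of_real mult_ac)
  then have "((\<lambda>x. trig A c x) has_derivative (\<lambda>v. \<Sum>\<xi>\<in>A. c \<xi> * (cis (\<xi> \<bullet> x) * (\<i> * of_real (\<xi> \<bullet> v))))) (at x)"
    unfolding trig_def by (intro has_derivative_sum has_derivative_mult_right)
  also have "(\<lambda>v. \<Sum>\<xi>\<in>A. c \<xi> * (cis (\<xi> \<bullet> x) * (\<i> * of_real (\<xi> \<bullet> v)))) = (\<lambda>v. trig A (\<lambda>\<xi>. \<i> * of_real (\<xi> \<bullet> v) * c \<xi>) x)"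
    unfolding trig_def by (simp only: mult_ac)
  finally show ?thesis by (rule bounded_linear.has_derivative[OF bounded_linear_Re])
qed

lemma pderivs_Re_trig:
  "pderivs \<gamma> (\<lambda>x. Re (trig A c x)) = (\<lambda>x. Re (trig A (\<lambda>\<xi>. (\<Prod>b\<leftarrow>\<gamma>. \<i> * of_real (\<xi> \<bullet> b)) * c \<xi>) x))"
proof (induction \<gamma>)
  case (Cons b \<gamma>)
  show ?case
    by (simp add: Cons frechet_derivative_at[OF has_derivative_Re_trig, symmetric] mult.assoc)
qed simp

lemma smooth_Rd_Re_trig: "smooth_Rd (\<lambda>x. Re (trig A c x))"
  unfolding smooth_Rd_def pderivs_Re_trig using has_derivative_Re_trig differentiableI by blast

lemma mult_bound_prod_list:
  "(\<And>b. b \<in> set \<gamma> \<Longrightarrow> mult_bound (m b) K) \<Longrightarrow> mult_bound (\<lambda>\<xi>. \<Prod>b\<leftarrow>\<gamma>. m b \<xi>) (K ^ length \<gamma>)"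
proof (induction \<gamma>)
  case Nil
  then show ?case using mult_bound_const[of 1] by simp
next
  case (Cons b \<gamma>)
  then show ?case by (simp add: mult_bound_mult)
qed

section \<open>Derivatives of the semigroup\<close>

lemma abs_le_sup_norm: "bounded (range f) \<Longrightarrow> \<bar>f x\<bar> \<le> sup_norm f" for f :: "'a \<Rightarrow> real"
proof -
  assume "bounded (range f)"
  then obtain a where "\<And>x. \<bar>f x\<bar> \<le> a" by (auto simp: bounded_iff)
  then show ?thesis unfolding sup_norm_def by (intro cSUP_upper bdd_aboveI2) auto
qed

text \<open>Exponentials are eigenfunctions of convolution with \<open>\<mu> t\<close>. Here alone
  the formula for the characteristic function enters.\<close>

lemma semigroup_trig:
  fixes \<mu> :: "real \<Rightarrow> 'a::euclidean_space measure"
  assumes law: "is_levy_law \<nu> t (\<mu> t)"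
    and F: "\<And>x. complex_of_real (F x) = trig A c x"
  shows "semigroup \<mu> t F = (\<lambda>x. Re (trig A (\<lambda>\<xi>. exp (- complex_of_real t * levy_exponent \<nu> \<xi>) * c \<xi>) x))"
proof
  fix x
  interpret prob_space "\<mu> t" using law by (simp add: is_levy_law_def)
  have sets: "sets (\<mu> t) = sets borel" using law by (simp add: is_levy_law_def)
  have m: "(\<lambda>y. cis (\<xi> \<bullet> y)) \<in> borel_measurable (\<mu> t)" for \<xi>
    unfolding measurable_cong_sets[OF sets refl] by (intro borel_measurable_continuous_onI continuous_intros)
  have i: "integrable (\<mu> t) (\<lambda>y. cis (\<xi> \<bullet> y))" for \<xi>
    by (rule integrable_const_bound[of _ 1]) (use m in simp_all)
  have "complex_of_real (semigroup \<mu> t F x) = (LINT y|\<mu> t. trig A c (x + y))"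
    unfolding semigroup_def F[symmetric] by simp
  also have "\<dots> = (LINT y|\<mu> t. (\<Sum>\<xi>\<in>A. (c \<xi> * cis (\<xi> \<bullet> x)) * cis (\<xi> \<bullet> y)))"
    by (simp add: trig_def inner_add_right cis_mult[symmetric] mult.assoc)
  also have "\<dots> = (\<Sum>\<xi>\<in>A. (c \<xi> * cis (\<xi> \<bullet> x)) * (LINT y|\<mu> t. cis (\<xi> \<bullet> y)))"
    by (subst Bochner_Integration.integral_sum) (simp_all only: integral_mult_right_zero integrable_mult_right[OF i])
  also have "\<dots> = trig A (\<lambda>\<xi>. exp (- complex_of_real t * levy_exponent \<nu> \<xi>) * c \<xi>) x"
    using law unfolding is_levy_law_def trig_def by (intro sum.cong) simp_all
  finally show "semigroup \<mu> t F x = Re (trig A (\<lambda>\<xi>. exp (- complex_of_real t * levy_exponent \<nu> \<xi>) * c \<xi>) x)"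
    by (metis Re_complex_of_real)
qed

text \<open>A derivative of order \<open>k\<close> is shared out among \<open>k\<close> of \<open>k + 1\<close> equal factors of the
  characteristic function.\<close>

lemma mult_bound_derivatives_levy:
  fixes \<phi> :: "real \<Rightarrow> real" and a0 :: "'a::euclidean_space \<Rightarrow> real"
  assumes adm: "admissible_order \<phi>" and \<Lambda>1: "0 < \<Lambda>1"
    and a0: "a0 \<in> borel_measurable borel" "\<And>h. h \<noteq> 0 \<Longrightarrow> a0 h \<in> {\<Lambda>1..\<Lambda>2}"
  shows "\<exists>C>0. \<forall>t>0. \<forall>\<gamma>. set \<gamma> \<subseteq> Basis \<longrightarrow> length \<gamma> = k \<longrightarrow>
     mult_bound (\<lambda>\<xi>. (\<Prod>b\<leftarrow>\<gamma>. \<i> * of_real (\<xi> \<bullet> b)) * exp (- complex_of_real t * levy_exponent (levy_measure a0 \<phi>) \<xi>))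
       (C * order_inv \<phi> t powr (- real k))"
proof -
  \<comment> \<open>One factor for each derivative and one spare; the spare keeps \<kappa> positive
    and the argument uniform when k = 0.\<close>
  define \<kappa> where "\<kappa> = 1 / (real k + 1)"
  have \<kappa>: "0 < \<kappa>" by (simp add: \<kappa>_def)
  let ?\<psi> = "levy_exponent (levy_measure a0 \<phi>)"
  obtain C where C: "0 < C" "\<And>t b. 0 < t \<Longrightarrow> b \<in> Basis \<Longrightarrow>
      mult_bound (\<lambda>\<xi>. \<i> * of_real (\<xi> \<bullet> b) * exp (- (of_real (\<kappa> * t) * ?\<psi> \<xi>))) (C / order_inv \<phi> t)"
    using mult_bound_derivative_levy[OF adm \<Lambda>1 a0 \<kappa>] by blast
  show ?thesis
  proof (intro exI[of _ "C ^ k"] conjI allI impI)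
    show "0 < C ^ k" using C(1) by simp
    fix t :: real and \<gamma> :: "'a list"
    assume t: "0 < t" and \<gamma>: "set \<gamma> \<subseteq> Basis" "length \<gamma> = k"
    let ?e = "\<lambda>\<xi>. exp (- (of_real (\<kappa> * t) * ?\<psi> \<xi>))"
    have L: "levy_density (jump_density a0 \<phi>)"
      by (rule levy_density_jump_density[OF adm \<Lambda>1 a0])
    have E: "?\<psi> \<xi> = density_exponent (jump_density a0 \<phi>) \<xi>" for \<xi>
      by (rule levy_exponent_eq[OF adm \<Lambda>1 a0])
    have "0 \<le> \<kappa> * t" using \<kappa> t by simp
    then have "levy_density (\<lambda>h. (\<kappa> * t) * jump_density a0 \<phi> h)"
      by (rule levy_density_cmult[OF L])
    then have "mult_bound (\<lambda>\<xi>. exp (- density_exponent (\<lambda>h. \<kappa> * t * jump_density a0 \<phi> h) \<xi>)) 1"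
      by (rule mult_bound_exp_density_exponent)
    then have "mult_bound ?e 1"
      by (simp only: density_exponent_cmult E)
    then have "mult_bound (\<lambda>\<xi>. (\<Prod>b\<leftarrow>\<gamma>. \<i> * of_real (\<xi> \<bullet> b) * ?e \<xi>) * ?e \<xi>) ((C / order_inv \<phi> t) ^ length \<gamma> * 1)"
      by (intro mult_bound_mult mult_bound_prod_list C(2) t) (use \<gamma> in auto)
    also have "(\<lambda>\<xi>. (\<Prod>b\<leftarrow>\<gamma>. \<i> * of_real (\<xi> \<bullet> b) * ?e \<xi>) * ?e \<xi>)
      = (\<lambda>\<xi>. (\<Prod>b\<leftarrow>\<gamma>. \<i> * of_real (\<xi> \<bullet> b)) * exp (- complex_of_real t * ?\<psi> \<xi>))"
    proof
      fix \<xi>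
      have "(\<Prod>b\<leftarrow>\<gamma>. \<i> * of_real (\<xi> \<bullet> b) * ?e \<xi>) = (\<Prod>b\<leftarrow>\<gamma>. \<i> * of_real (\<xi> \<bullet> b)) * ?e \<xi> ^ length \<gamma>"
        by (induction \<gamma>) simp_all
      moreover have "?e \<xi> ^ length \<gamma> * ?e \<xi> = exp (- complex_of_real t * ?\<psi> \<xi>)"
      proof -
        have "?e \<xi> ^ length \<gamma> * ?e \<xi> = exp (of_nat (Suc k) * - (of_real (\<kappa> * t) * ?\<psi> \<xi>))"
          unfolding exp_of_nat_mult \<gamma>(2) by simp
        also have "of_nat (Suc k) * - (of_real (\<kappa> * t) * ?\<psi> \<xi>) = - (of_real (real (Suc k) * \<kappa> * t) * ?\<psi> \<xi>)"
          by (simp only: of_real_mult of_real_of_nat_eq mult_minus_right mult.assoc)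
        also have "real (Suc k) * \<kappa> = 1" by (simp add: \<kappa>_def)
        finally show ?thesis by simp
      qed
      ultimately show "(\<Prod>b\<leftarrow>\<gamma>. \<i> * of_real (\<xi> \<bullet> b) * ?e \<xi>) * ?e \<xi>
          = (\<Prod>b\<leftarrow>\<gamma>. \<i> * of_real (\<xi> \<bullet> b)) * exp (- complex_of_real t * ?\<psi> \<xi>)"
        by (simp only: mult.assoc)
    qed
    also have "(C / order_inv \<phi> t) ^ length \<gamma> * 1 = C ^ k * order_inv \<phi> t powr (- real k)"
      using order_inv(1)[OF adm t] by (simp add: \<gamma>(2) powr_minus powr_realpow divide_inverse power_mult_distrib power_inverse)
    finally show "mult_bound (\<lambda>\<xi>. (\<Prod>b\<leftarrow>\<gamma>. \<i> * of_real (\<xi> \<bullet> b)) * exp (- complex_of_real t * ?\<psi> \<xi>))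
      (C ^ k * order_inv \<phi> t powr (- real k))" .
  qed
qed

lemma tendsto_semigroup:
  fixes \<mu> :: "real \<Rightarrow> 'a::euclidean_space measure"
  assumes law: "is_levy_law \<nu> t (\<mu> t)"
    and cont: "\<And>n. continuous_on UNIV (F n)" "continuous_on UNIV f"
    and bound: "\<And>n x. \<bar>F n x\<bar> \<le> B" and lim: "\<And>x. (\<lambda>n. F n x) \<longlonglongrightarrow> f x"
  shows "(\<lambda>n. semigroup \<mu> t (F n) x) \<longlonglongrightarrow> semigroup \<mu> t f x"
  unfolding semigroup_def
proof (rule integral_dominated_convergence)
  interpret prob_space "\<mu> t" using law by (simp add: is_levy_law_def)
  have sets: "sets (\<mu> t) = sets borel" using law by (simp add: is_levy_law_def)
  have m: "(\<lambda>y. g (x + y)) \<in> borel_measurable (\<mu> t)" if "continuous_on UNIV g" for g :: "'a \<Rightarrow> real"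
    unfolding measurable_cong_sets[OF sets refl]
    by (intro borel_measurable_continuous_onI continuous_on_compose2[OF that]) (auto intro: continuous_intros)
  show "(\<lambda>y. f (x + y)) \<in> borel_measurable (\<mu> t)" by (rule m[OF cont(2)])
  show "(\<lambda>y. F n (x + y)) \<in> borel_measurable (\<mu> t)" for n by (rule m[OF cont(1)])
  show "integrable (\<mu> t) (\<lambda>_. B)" by simp
qed (use bound lim in auto)

theorem theorem3p3:
  fixes \<phi> :: "real \<Rightarrow> real"
    and a0 :: "'a::euclidean_space \<Rightarrow> real"
    and \<Lambda>1 \<Lambda>2 :: real
    and \<mu> :: "real \<Rightarrow> 'a measure"
  assumes "admissible_order \<phi>"
    and "0 < \<Lambda>1" and "\<Lambda>1 \<le> \<Lambda>2"
    and "a0 \<in> borel_measurable borel"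
    and "\<And>h. h \<noteq> 0 \<Longrightarrow> a0 h \<in> {\<Lambda>1..\<Lambda>2}"
    and "\<And>t. t > 0 \<Longrightarrow> is_levy_law (levy_measure a0 \<phi>) t (\<mu> t)"
  shows "(\<forall>f t. continuous_on UNIV f \<and> bounded (range f) \<and> t > 0
             \<longrightarrow> smooth_Rd (semigroup \<mu> t f)) \<and>
         (\<forall>k::nat. \<exists>C>0. \<forall>f \<gamma> t x.
             continuous_on UNIV f \<and> bounded (range f) \<and>
             set \<gamma> \<subseteq> Basis \<and> length \<gamma> = k \<and> t > 0 \<longrightarrow>
             \<bar>pderivs \<gamma> (semigroup \<mu> t f) x\<bar>
               \<le> C * order_inv \<phi> t powr (- real k) * sup_norm f)"
proof -
  let ?\<psi> = "levy_exponent (levy_measure a0 \<phi>)"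
  let ?P = "\<lambda>k C. \<forall>t>0. \<forall>\<gamma>. set \<gamma> \<subseteq> Basis \<longrightarrow> length \<gamma> = k \<longrightarrow>
     mult_bound (\<lambda>\<xi>. (\<Prod>b\<leftarrow>\<gamma>. \<i> * of_real (\<xi> \<bullet> b)) * exp (- complex_of_real t * ?\<psi> \<xi>))
       (C * order_inv \<phi> t powr (- real k))"
  have "\<forall>k. \<exists>C>0. ?P k C"
    by (rule allI, rule mult_bound_derivatives_levy[OF assms(1,2,4,5)])
  \<comment> \<open>All orders at once, before \<open>f\<close> and \<open>t\<close> are fixed: the
    estimate at one order draws on bounds at higher orders for the passage to the limit.\<close>
  from choice[OF this] obtain C where "\<forall>k. 0 < C k \<and> ?P k (C k)" by blast
  then have C: "0 < C k" "\<And>t \<gamma>. 0 < t \<Longrightarrow> set \<gamma> \<subseteq> Basis \<Longrightarrow> length \<gamma> = k \<Longrightarrow>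
     mult_bound (\<lambda>\<xi>. (\<Prod>b\<leftarrow>\<gamma>. \<i> * of_real (\<xi> \<bullet> b)) * exp (- complex_of_real t * ?\<psi> \<xi>))
       (C k * order_inv \<phi> t powr (- real k))" for k
    by simp_all
  have main: "pderivs \<gamma> (semigroup \<mu> t f) differentiable (at x) \<and>
      \<bar>pderivs \<gamma> (semigroup \<mu> t f) x\<bar> \<le> C (length \<gamma>) * order_inv \<phi> t powr (- real (length \<gamma>)) * sup_norm f"
    if f: "continuous_on UNIV f" "bounded (range f)" and t: "0 < t" and \<gamma>: "set \<gamma> \<subseteq> Basis" for f t \<gamma> x
  proof -
    let ?S = "sup_norm f" and ?K = "\<lambda>k. C k * order_inv \<phi> t powr (- real k)"
    note law = assms(6)[OF t]
    obtain F where F: "\<And>n. trig_poly (\<lambda>x. complex_of_real (F n x))"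
      "\<And>n x. \<bar>F n x\<bar> \<le> ?S + inverse (real (Suc n))" "\<And>x. (\<lambda>n. F n x) \<longlonglongrightarrow> f x"
      using trig_poly_approximation[OF f(1) abs_le_sup_norm[OF f(2)]] by blast
    have "\<forall>n. \<exists>A c. finite A \<and> (\<forall>x. complex_of_real (F n x) = trig A c x)"
      using F(1) unfolding trig_poly_def by metis
    then obtain A c where Ac: "\<And>n. finite (A n)" "\<And>n x. complex_of_real (F n x) = trig (A n) (c n) x"
      by metis
    have norm_F: "cmod (trig (A n) (c n) x) \<le> ?S + inverse (real (Suc n))" for n x
      using F(2)[of n x] unfolding Ac(2)[symmetric] norm_of_real .
    define u where "u n = semigroup \<mu> t (F n)" for n
    have u: "u n = (\<lambda>x. Re (trig (A n) (\<lambda>\<xi>. exp (- complex_of_real t * ?\<psi> \<xi>) * c n \<xi>) x))" for n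
      unfolding u_def by (rule semigroup_trig) (rule law, rule Ac(2))
    have bound: "\<bar>pderivs \<gamma> (u n) x\<bar> \<le> ?K (length \<gamma>) * (?S + inverse (real (Suc n)))" if "set \<gamma> \<subseteq> Basis" for n \<gamma> x
      unfolding u pderivs_Re_trig mult.assoc[symmetric]
      by (rule order_trans[OF abs_Re_le_cmod mult_boundD[OF C(2)[OF t that refl] Ac(1) norm_F]])
    have K0: "0 \<le> ?K k" for k using C(1)[of k] by simp
    \<comment> \<open>The cruder \<open>?S + 1\<close> is uniform in \<open>n\<close> and serves
      convergence and domination; the sharper bound is kept for the limit, where the excess
      disappears.\<close>
    have "?S + inverse (real (Suc n)) \<le> ?S + 1" for n by (simp add: inverse_le_1_iff)
    then have bound1: "\<bar>pderivs \<gamma> (u n) x\<bar> \<le> ?K (length \<gamma>) * (?S + 1)" if "set \<gamma> \<subseteq> Basis" for n \<gamma> x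
      using order_trans[OF bound[OF that] mult_left_mono[OF _ K0]] by blast
    have cont: "continuous_on UNIV (F n)" for n
    proof -
      have "F n = (\<lambda>x. Re (trig (A n) (c n) x))" using Ac(2)[of n] by (metis Re_complex_of_real)
      then show ?thesis unfolding trig_def by (simp only:) (intro continuous_intros)
    qed
    have lim: "(\<lambda>n. u n x) \<longlonglongrightarrow> semigroup \<mu> t f x" for x
      unfolding u_def
    proof (rule tendsto_semigroup[where F = F and \<mu> = \<mu> and t = t, OF law cont f(1) _ F(3)])
      show "\<bar>F n x\<bar> \<le> ?S + 1" for n x
        using order_trans[OF F(2)[of n x], of "?S + 1"] by (simp add: inverse_le_1_iff)
    qed
    have smooth: "smooth_Rd (u n)" for n unfolding u by (rule smooth_Rd_Re_trig)
    have limit: "(\<lambda>n. pderivs \<gamma> (u n) x) \<longlonglongrightarrow> pderivs \<gamma> (semigroup \<mu> t f) x"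
      by (rule tendsto_pderivs(1)[of u "\<lambda>k. ?K k * (?S + 1)", OF smooth bound1 lim \<gamma>])
    have diff: "pderivs \<gamma> (semigroup \<mu> t f) differentiable (at x)"
      by (rule tendsto_pderivs(2)[of u "\<lambda>k. ?K k * (?S + 1)", OF smooth bound1 lim \<gamma>])
    have "(\<lambda>n. ?K (length \<gamma>) * (?S + inverse (real (Suc n)))) \<longlonglongrightarrow> ?K (length \<gamma>) * (?S + 0)"
      by (intro tendsto_intros LIMSEQ_inverse_real_of_nat)
    then have "\<bar>pderivs \<gamma> (semigroup \<mu> t f) x\<bar> \<le> ?K (length \<gamma>) * (?S + 0)"
      by (rule LIMSEQ_le[OF tendsto_rabs[OF limit]]) (use bound[OF \<gamma>] in blast)
    then show ?thesis using diff by simp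
  qed
  show ?thesis
  proof (intro conjI allI impI)
    show "smooth_Rd (semigroup \<mu> t f)" if "continuous_on UNIV f \<and> bounded (range f) \<and> t > 0" for f t
      unfolding smooth_Rd_def using main that by blast
    show "\<exists>C>0. \<forall>f \<gamma> t x. continuous_on UNIV f \<and> bounded (range f) \<and>
             set \<gamma> \<subseteq> Basis \<and> length \<gamma> = k \<and> t > 0 \<longrightarrow>
             \<bar>pderivs \<gamma> (semigroup \<mu> t f) x\<bar> \<le> C * order_inv \<phi> t powr (- real k) * sup_norm f" for k
      using main C(1) by (intro exI[of _ "C k"]) blast
  qed
qed

end
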